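(* For $b\ge2$, \[ \Phi_b(x,z)=\frac{1}{(2\pi i)^{2(b-1)}}\int_{\mathcal C}\prod_{2\le i<j\le b}(x_j-x_i)\cdot\frac{F(X,Z)}{X^b}\prod_{i=2}^b\frac{Xx_i-x}{z_i^{\,i}}F\!\left(\frac{x}{x_i},\frac{z}{z_i}\right)dx_i\,dz_i, \] where $X=x_2\cdots x_b$, $Z=z_2\cdots z_b$ and $\mathcal C=\{|x_2|=1\}\times\cdots\times\{|x_b|=1\}\times\{|z_2|=1\}\times\cdots\times\{|z_b|=1\}$ is positively oriented.
   Context: $\alpha,\beta,\gamma$ are positive integers; $\{\alpha\}^a$ is $\alpha$ repeated $a$ times. For $\boldsymbol k\in\mathbb{N}^d$, $\zeta^M(\boldsymbol k)=\sum_{1\le m_1<\cdots<m_d\le M}\prod m_i^{-k_i}$ and $\zeta^\ast(\boldsymbol k)=Z^\ast(\boldsymbol k;0)$ with $Z^\ast(\boldsymbol k;T)\in\mathbb{R}[T]$ the unique polynomial such that $\zeta^M(\boldsymbol k)=Z^\ast(\boldsymbol k;\log M+\gamma_E)+O(\log^JM/M)$ for some $J>0$ ($\gamma_E$ Euler's constant). Likewise for a partition $\lambda$ and filling $\boldsymbol k$ of $D(\lambda)$ by positive integers, $\zeta^M_\lambda(\boldsymbol k)=\sum\prod t_{i,j}^{-k_{i,j}}$ over semistandard tableaux of shape $\lambda$ with entries in $\{1,\ldots,M\}$, and $\zeta^\ast_\lambda(\boldsymbol k)$ is the constant term of the analogous unique polynomial $Z^\ast_\lambda(\boldsymbol k;T)$.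 $R^{(m)}_{p,q}=\zeta^\ast_{(q^p)}$ of the filling $(a_{j-i+m})_{(i,j)}$ with $a_c=\gamma$ ($c<0$), $a_0=\beta$, $a_c=\alpha$ ($c>0$). $F(x,z)=\sum_{a,c\ge0}\zeta^\ast(\{\alpha\}^a,\beta,\{\gamma\}^c)x^az^c$ and $\Phi_b(x,z)=x^{\frac12b(b-1)}z^{\frac12(b-1)(b-2)}\sum_{a,c\ge0}R^{(a)}_{a+b+c,b}x^{(b-1)a}z^{(b-1)c}$. The identity is of formal power series; the normalized integral over $\mathcal C$ means the coefficient of $\prod_{i=2}^bx_i^{-1}z_i^{-1}$ in the Laurent expansion of the integrand in $x_2,\ldots,z_b$. *)

theory Defs
  imports
    "HOL-Library.Poly_Mapping"
    "HOL-Library.FuncSet"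
    "HOL-Library.Landau_Symbols"
    "HOL-Analysis.Harmonic_Numbers"
    "HOL-Computational_Algebra.Polynomial"
begin

section \<open>Multiple zeta values and Schur multiple zeta values\<close>

definition mzv_trunc :: "nat list \<Rightarrow> nat \<Rightarrow> real" where
  "mzv_trunc k M =
     (\<Sum>m | length m = length k \<and> set m \<subseteq> {1..M} \<and> sorted_wrt (<) m.
        \<Prod>i<length k. 1 / real (m ! i) ^ (k ! i))"

definition asymp_poly :: "(nat \<Rightarrow> real) \<Rightarrow> real poly" where
  "asymp_poly s = (THE P. \<exists>J::nat. J > 0 \<and>
     (\<lambda>M. s M - poly P (ln (real M) + euler_mascheroni)) \<in> O(\<lambda>M. ln (real M) ^ J / real M))"

definition mzv_reg :: "nat list \<Rightarrow> real" where
  "mzv_reg k = poly (asymp_poly (mzv_trunc k)) 0"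

text \<open>
  A partition is the list of its row lengths; rows and columns are numbered from 1. Tableaux are
  extensional functions on the diagram, so that they form a finite set.
\<close>

definition diagram :: "nat list \<Rightarrow> (nat \<times> nat) set" where
  "diagram shp = {(i, j). 1 \<le> i \<and> i \<le> length shp \<and> 1 \<le> j \<and> j \<le> shp ! (i - 1)}"

definition ssyt :: "nat list \<Rightarrow> nat \<Rightarrow> (nat \<times> nat \<Rightarrow> nat) set" where
  "ssyt shp M = {t \<in> diagram shp \<rightarrow>\<^sub>E {1..M}.
     (\<forall>i j. (i, j) \<in> diagram shp \<and> (i, j + 1) \<in> diagram shp \<longrightarrow> t (i, j) \<le> t (i, j + 1)) \<and>
     (\<forall>i j. (i, j) \<in> diagram shp \<and> (i + 1, j) \<in> diagram shp \<longrightarrow> t (i, j) < t (i + 1, j))}"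

definition schur_mzv_trunc :: "nat list \<Rightarrow> (nat \<times> nat \<Rightarrow> nat) \<Rightarrow> nat \<Rightarrow> real" where
  "schur_mzv_trunc shp k M = (\<Sum>t \<in> ssyt shp M. \<Prod>c \<in> diagram shp. 1 / real (t c) ^ k c)"

definition schur_mzv_reg :: "nat list \<Rightarrow> (nat \<times> nat \<Rightarrow> nat) \<Rightarrow> real" where
  "schur_mzv_reg shp k = poly (asymp_poly (schur_mzv_trunc shp k)) 0"

definition content_index :: "nat \<Rightarrow> nat \<Rightarrow> nat \<Rightarrow> int \<Rightarrow> nat" where
  "content_index \<alpha> \<beta> \<gamma> c = (if c < 0 then \<gamma> else if c = 0 then \<beta> else \<alpha>)"

text \<open>\<open>Rect \<alpha> \<beta> \<gamma> m p q\<close> is \<open>R\<^sup>(\<^sup>m\<^sup>)\<close> for the rectangle with \<open>p\<close> rows of length \<open>q\<close>.\<close>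

definition Rect :: "nat \<Rightarrow> nat \<Rightarrow> nat \<Rightarrow> nat \<Rightarrow> nat \<Rightarrow> nat \<Rightarrow> real" where
  "Rect \<alpha> \<beta> \<gamma> m p q =
     schur_mzv_reg (replicate p q) (\<lambda>(i, j). content_index \<alpha> \<beta> \<gamma> (int j - int i + int m))"


section \<open>Formal Laurent series in several variables\<close>

text \<open>
  The integrand is a power series in \<open>x, z\<close> whose coefficients are Laurent series in the other
  variables, involving both \<open>F(X,Z)\<close> and \<open>F(x/x\<^sub>i, z/z\<^sub>i)\<close>. All of these live in the ring
  of Hahn series, that is of functions on a linearly ordered abelian group of exponents whose
  support is well-ordered.
\<close>

lemma wfp_on_less_iff_seq:
  fixes A :: "'g::linorder set"
  shows "wfp_on A (<) \<longleftrightarrow> \<not> (\<exists>s::nat \<Rightarrow> 'g. \<forall>n. s n \<in> A \<and> s (Suc n) < s n)"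
proof -
  have "wfp_on A (<) \<longleftrightarrow> wfp (\<lambda>x y. x < y \<and> x \<in> A \<and> y \<in> A)"
    by (rule wfp_on_iff_wfp)
  also have "\<dots> \<longleftrightarrow> wf {(x, y). x < y \<and> x \<in> A \<and> y \<in> A}"
    by (simp add: wfp_def)
  also have "\<dots> \<longleftrightarrow> \<not> (\<exists>s::nat \<Rightarrow> 'g. \<forall>n. s n \<in> A \<and> s (Suc n) < s n)"
    unfolding wf_iff_no_infinite_down_chain by auto
  finally show ?thesis .
qed

lemma wfp_on_less_seq_incr:
  fixes A :: "'g::linorder set"
  assumes "wfp_on A (<)" and s: "\<And>n. s n \<in> A"
  obtains f :: "nat \<Rightarrow> nat" where "strict_mono f" "\<And>m n. m \<le> n \<Longrightarrow> s (f m) \<le> s (f n)"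
proof -
  obtain f :: "nat \<Rightarrow> nat" where f: "strict_mono f" and mon: "monoseq (\<lambda>n. s (f n))"
    using seq_monosub by blast
  show thesis
  proof (cases "\<forall>m. \<forall>n\<ge>m. s (f m) \<le> s (f n)")
    case True
    then show ?thesis using f that by blast
  next
    case False
    then have dec: "\<forall>m. \<forall>n\<ge>m. s (f n) \<le> s (f m)"
      using mon unfolding monoseq_def by auto
    have "range (\<lambda>n. s (f n)) \<subseteq> A" "range (\<lambda>n. s (f n)) \<noteq> {}"
      using s by auto
    then obtain z where "z \<in> range (\<lambda>n. s (f n))"
      and z: "\<forall>y. y < z \<longrightarrow> y \<notin> range (\<lambda>n. s (f n))"
      using assms(1) unfolding wfp_on_iff_ex_minimal by meson
    then obtain N where N: "z = s (f N)" by auto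
    have const: "s (f n) = s (f N)" if "n \<ge> N" for n
    proof -
      have "s (f n) \<le> s (f N)" using dec that by blast
      moreover have "\<not> s (f n) < s (f N)" using z N by blast
      ultimately show ?thesis by simp
    qed
    show ?thesis
    proof (rule that)
      show "strict_mono (\<lambda>n. f (n + N))"
        using f by (simp add: strict_mono_def)
      show "s (f (m + N)) \<le> s (f (n + N))" if "m \<le> n" for m n
        using const[of "m + N"] const[of "n + N"] by simp
    qed
  qed
qed

lemma wfp_on_singleton:
  fixes u :: "'g::order"
  shows "wfp_on {u} (<)"
  unfolding wfp_on_def by auto

lemma wfp_on_less_Un:
  fixes A B :: "'g::linorder set"
  assumes "wfp_on A (<)" "wfp_on B (<)"
  shows "wfp_on (A \<union> B) (<)"
  unfolding wfp_on_iff_ex_minimal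
proof (intro allI impI)
  fix S assume S: "S \<subseteq> A \<union> B" "S \<noteq> {}"
  consider "S \<inter> A = {}" | "S \<inter> B = {}" | "S \<inter> A \<noteq> {}" "S \<inter> B \<noteq> {}" by blast
  then show "\<exists>z\<in>S. \<forall>y<z. y \<notin> S"
  proof cases
    case 1
    then have "S \<subseteq> B" using S by blast
    then show ?thesis using assms(2) S(2) unfolding wfp_on_iff_ex_minimal by blast
  next
    case 2
    then have "S \<subseteq> A" using S by blast
    then show ?thesis using assms(1) S(2) unfolding wfp_on_iff_ex_minimal by blast
  next
    case 3
    obtain u where u: "u \<in> S \<inter> A" "\<forall>y<u. y \<notin> S \<inter> A"
      using assms(1) 3(1) unfolding wfp_on_iff_ex_minimal by (meson inf_le2)
    obtain v where v: "v \<in> S \<inter> B" "\<forall>y<v. y \<notin> S \<inter> B"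
      using assms(2) 3(2) unfolding wfp_on_iff_ex_minimal by (meson inf_le2)
    have "min u v \<in> S" using u(1) v(1) by (auto simp: min_def)
    moreover have "y \<notin> S" if "y < min u v" for y
      using that u(2) v(2) S(1) by (meson IntI Un_iff min_less_iff_conj subsetD)
    ultimately show ?thesis by blast
  qed
qed

lemma wfp_on_less_sumset:
  fixes A B :: "'g::linordered_ab_group_add set"
  assumes A: "wfp_on A (<)" and B: "wfp_on B (<)"
  shows "wfp_on {u + v |u v. u \<in> A \<and> v \<in> B} (<)"
  unfolding wfp_on_less_iff_seq
proof
  assume "\<exists>s::nat \<Rightarrow> 'g. \<forall>n. s n \<in> {u + v |u v. u \<in> A \<and> v \<in> B} \<and> s (Suc n) < s n"
  then obtain s :: "nat \<Rightarrow> 'g"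
    where s: "\<forall>n. \<exists>u v. s n = u + v \<and> u \<in> A \<and> v \<in> B" and dec: "\<And>n. s (Suc n) < s n"
    by blast
  then obtain u v where uv: "\<And>n. s n = u n + v n" "\<And>n. u n \<in> A" "\<And>n. v n \<in> B"
    by metis
  obtain f :: "nat \<Rightarrow> nat" where f: "strict_mono f" "\<And>m n. m \<le> n \<Longrightarrow> u (f m) \<le> u (f n)"
    using wfp_on_less_seq_incr[where s = u, OF A uv(2)] by blast
  have "v (f (Suc n)) < v (f n)" for n
  proof (rule ccontr)
    assume "\<not> ?thesis"
    then have "u (f n) + v (f n) \<le> u (f (Suc n)) + v (f (Suc n))"
      using f(2)[of n "Suc n"] by (intro add_mono) auto
    then have "s (f n) \<le> s (f (Suc n))" by (simp add: uv)
    moreover have "s (f (Suc n)) < s (f n)"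
    proof (rule lift_Suc_mono_less[of "\<lambda>n. - s n", simplified])
      show "s (Suc n) < s n" for n by (rule dec)
      show "f n < f (Suc n)" using f(1) by (simp add: strict_mono_Suc_iff)
    qed
    ultimately show False by simp
  qed
  moreover have "v (f n) \<in> B" for n by (rule uv)
  ultimately show False
    using B unfolding wfp_on_less_iff_seq by (auto dest: spec[of _ "\<lambda>n. v (f n)"])
qed

lemma finite_sum_decompositions:
  fixes A B :: "'g::linordered_ab_group_add set"
  assumes A: "wfp_on A (<)" and B: "wfp_on B (<)"
  shows "finite {(u, v). u \<in> A \<and> v \<in> B \<and> u + v = e}"
proof (rule ccontr)
  let ?U = "{u \<in> A. e - u \<in> B}"
  assume inf: "infinite {(u, v). u \<in> A \<and> v \<in> B \<and> u + v = e}"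
  have "{(u, v). u \<in> A \<and> v \<in> B \<and> u + v = e} \<subseteq> (\<lambda>u. (u, e - u)) ` ?U" by force
  then have "infinite ?U" using inf finite_surj by blast
  then obtain s :: "nat \<Rightarrow> 'g" where s: "inj s" "range s \<subseteq> ?U"
    using infinite_countable_subset by blast
  obtain f :: "nat \<Rightarrow> nat" where f: "strict_mono f" "\<And>m n. m \<le> n \<Longrightarrow> s (f m) \<le> s (f n)"
    using wfp_on_less_seq_incr[where s = s, OF A] s(2) by blast
  have "s (f n) < s (f (Suc n))" for n
  proof -
    have "f n \<noteq> f (Suc n)" using f(1) by (metis n_not_Suc_n strict_mono_eq)
    then have "s (f n) \<noteq> s (f (Suc n))" using s(1) by (simp add: inj_eq)
    then show ?thesis using f(2)[of n "Suc n"] by simp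
  qed
  then have "\<forall>n. e - s (f n) \<in> B \<and> e - s (f (Suc n)) < e - s (f n)"
    using s(2) by auto
  then show False
    using B unfolding wfp_on_less_iff_seq by (auto dest: spec[of _ "\<lambda>n. e - s (f n)"])
qed

typedef (overloaded) ('g::linordered_ab_group_add, 'a::zero) hahn =
  "{f :: 'g \<Rightarrow> 'a. wfp_on {e. f e \<noteq> 0} (<)}"
  morphisms hcoeff Abs_hahn
  by (rule exI[of _ "\<lambda>_. 0"]) (simp add: wfp_on_def)

setup_lifting type_definition_hahn

definition hsupp :: "('g::linordered_ab_group_add, 'a::zero) hahn \<Rightarrow> 'g set" where
  "hsupp f = {e. hcoeff f e \<noteq> 0}"

lemma wfp_on_hsupp: "wfp_on (hsupp f) (<)"
  using hcoeff[of f] by (simp add: hsupp_def)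

lemma not_in_hsupp: "e \<notin> hsupp f \<longleftrightarrow> hcoeff f e = 0"
  by (simp add: hsupp_def)

lemma hahn_eqI: "(\<And>e. hcoeff f e = hcoeff g e) \<Longrightarrow> f = g"
  by (metis ext hcoeff_inject)

lift_definition hmonom :: "'a::zero \<Rightarrow> 'g \<Rightarrow> ('g::linordered_ab_group_add, 'a) hahn" is
  "\<lambda>a e e'. if e' = e then a else 0"
proof -
  fix a :: 'a and e :: 'g
  have "wfp_on {e} (<)" unfolding wfp_on_def by auto
  then show "wfp_on {e'. (if e' = e then a else 0) \<noteq> 0} (<)"
    by (rule wfp_on_subset) auto
qed

instantiation hahn :: (linordered_ab_group_add, comm_ring_1) comm_ring_1
begin

lift_definition zero_hahn :: "('a, 'b) hahn" is "\<lambda>_. 0"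
  by (simp add: wfp_on_def)

definition one_hahn :: "('a, 'b) hahn" where "one_hahn = hmonom 1 0"

lift_definition plus_hahn :: "('a, 'b) hahn \<Rightarrow> ('a, 'b) hahn \<Rightarrow> ('a, 'b) hahn" is
  "\<lambda>f g e. f e + g e"
  by (rule wfp_on_subset[OF wfp_on_less_Un], assumption, assumption) auto

lift_definition uminus_hahn :: "('a, 'b) hahn \<Rightarrow> ('a, 'b) hahn" is "\<lambda>f e. - f e"
  by simp

lift_definition minus_hahn :: "('a, 'b) hahn \<Rightarrow> ('a, 'b) hahn \<Rightarrow> ('a, 'b) hahn" is
  "\<lambda>f g e. f e - g e"
  by (rule wfp_on_subset[OF wfp_on_less_Un], assumption, assumption) auto

lift_definition times_hahn :: "('a, 'b) hahn \<Rightarrow> ('a, 'b) hahn \<Rightarrow> ('a, 'b) hahn" is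
  "\<lambda>f g e. \<Sum>(u, v) | f u \<noteq> 0 \<and> g v \<noteq> 0 \<and> u + v = e. f u * g v"
proof -
  fix f g :: "'a \<Rightarrow> 'b"
  assume *: "wfp_on {e. f e \<noteq> 0} (<)" "wfp_on {e. g e \<noteq> 0} (<)"
  show "wfp_on {e. (\<Sum>(u, v) | f u \<noteq> 0 \<and> g v \<noteq> 0 \<and> u + v = e. f u * g v) \<noteq> 0} (<)"
  proof (rule wfp_on_subset[OF wfp_on_less_sumset[OF *]], rule)
    fix e assume "e \<in> {e. (\<Sum>(u, v) | f u \<noteq> 0 \<and> g v \<noteq> 0 \<and> u + v = e. f u * g v) \<noteq> 0}"
    then have "{(u, v). f u \<noteq> 0 \<and> g v \<noteq> 0 \<and> u + v = e} \<noteq> {}"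
      by (intro notI) simp
    then show "e \<in> {u + v |u v. u \<in> {e. f e \<noteq> 0} \<and> v \<in> {e. g e \<noteq> 0}}" by auto
  qed
qed

lemma hcoeff_times_superset:
  fixes f g :: "('a, 'b) hahn"
  assumes "wfp_on A (<)" "wfp_on B (<)" "hsupp f \<subseteq> A" "hsupp g \<subseteq> B"
  shows "hcoeff (f * g) e = (\<Sum>(u, v) | u \<in> A \<and> v \<in> B \<and> u + v = e. hcoeff f u * hcoeff g v)"
  unfolding times_hahn.rep_eq
proof (rule sum.mono_neutral_left)
  show "finite {(u, v). u \<in> A \<and> v \<in> B \<and> u + v = e}"
    by (rule finite_sum_decompositions) fact+
qed (use assms(3,4) in \<open>auto simp: hsupp_def\<close>)

lemma hsupp_times:
  fixes f g :: "('a, 'b) hahn"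
  shows "hsupp (f * g) \<subseteq> {u + v |u v. u \<in> hsupp f \<and> v \<in> hsupp g}"
proof
  fix e assume "e \<in> hsupp (f * g)"
  then have "(\<Sum>(u, v) | u \<in> hsupp f \<and> v \<in> hsupp g \<and> u + v = e. hcoeff f u * hcoeff g v) \<noteq> 0"
    by (simp add: hsupp_def times_hahn.rep_eq)
  then have "{(u, v). u \<in> hsupp f \<and> v \<in> hsupp g \<and> u + v = e} \<noteq> {}"
    by (intro notI) simp
  then show "e \<in> {u + v |u v. u \<in> hsupp f \<and> v \<in> hsupp g}" by auto
qed

lemma hahn_assoc:
  fixes f g h :: "('a, 'b) hahn"
  shows "hcoeff (f * g * h) e =
    (\<Sum>(u, v, w) | u \<in> hsupp f \<and> v \<in> hsupp g \<and> w \<in> hsupp h \<and> u + v + w = e.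
       hcoeff f u * hcoeff g v * hcoeff h w)"
proof -
  let ?A = "{u + v |u v. u \<in> hsupp f \<and> v \<in> hsupp g}"
  note wf = wfp_on_hsupp[of f] wfp_on_hsupp[of g] wfp_on_hsupp[of h]
  note wfA = wfp_on_less_sumset[OF wf(1,2)]
  let ?P = "{(s, w). s \<in> ?A \<and> w \<in> hsupp h \<and> s + w = e}"
  let ?Q = "\<lambda>s. {(u, v). u \<in> hsupp f \<and> v \<in> hsupp g \<and> u + v = s}"
  have "hcoeff (f * g * h) e = (\<Sum>(s, w)\<in>?P. hcoeff (f * g) s * hcoeff h w)"
    by (rule hcoeff_times_superset[OF wfA wf(3) hsupp_times order.refl])
  also have "\<dots> = (\<Sum>p\<in>?P. \<Sum>q\<in>?Q (fst p). hcoeff f (fst q) * hcoeff g (snd q) * hcoeff h (snd p))"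
    by (simp add: hcoeff_times_superset[OF wf(1,2) order.refl order.refl] sum_distrib_right case_prod_beta)
  also have "\<dots> = (\<Sum>(p, q)\<in>Sigma ?P (\<lambda>p. ?Q (fst p)).
      hcoeff f (fst q) * hcoeff g (snd q) * hcoeff h (snd p))"
    by (rule sum.Sigma)
       (use finite_sum_decompositions[OF wfA wf(3)] finite_sum_decompositions[OF wf(1,2)] in auto)
  also have "\<dots> = (\<Sum>(u, v, w) | u \<in> hsupp f \<and> v \<in> hsupp g \<and> w \<in> hsupp h \<and> u + v + w = e.
       hcoeff f u * hcoeff g v * hcoeff h w)"
    by (rule sum.reindex_bij_witness
          [of _ "\<lambda>(u, v, w). ((u + v, w), (u, v))" "\<lambda>((s, w), (u, v)). (u, v, w)"]) auto
  finally show ?thesis .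
qed

lemma hahn_commute:
  fixes f g :: "('a, 'b) hahn"
  shows "f * g = g * f"
proof (rule hahn_eqI)
  show "hcoeff (f * g) e = hcoeff (g * f) e" for e
    unfolding times_hahn.rep_eq
    by (rule sum.reindex_bij_witness[of _ "\<lambda>(u, v). (v, u)" "\<lambda>(u, v). (v, u)"])
       (auto simp: mult.commute add.commute)
qed

instance
proof
  fix f g h :: "('a, 'b) hahn"
  show "f + g + h = f + (g + h)" by transfer (simp add: add.assoc)
  show "f + g = g + f" by transfer (simp add: add.commute)
  show "0 + f = f" by transfer simp
  show "- f + f = 0" by transfer simp
  show "f - g = f + - g" by transfer simp
  show "f * g = g * f" by (rule hahn_commute)
  show "f * g * h = f * (g * h)"
  proof (rule hahn_eqI)
    fix e
    have "hcoeff (f * (g * h)) e = hcoeff (g * h * f) e" by (simp add: hahn_commute)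
    also have "\<dots> = hcoeff (f * g * h) e"
      unfolding hahn_assoc
      by (rule sum.reindex_bij_witness[of _ "\<lambda>(u, v, w). (v, w, u)" "\<lambda>(v, w, u). (u, v, w)"])
         (auto simp: ac_simps)
    finally show "hcoeff (f * g * h) e = hcoeff (f * (g * h)) e" by simp
  qed
  show "1 * f = f"
  proof (rule hahn_eqI)
    fix e
    have "hcoeff (1 * f) e
        = (\<Sum>(u, v) | u \<in> {0} \<and> v \<in> hsupp f \<and> u + v = e. hcoeff (1::('a,'b) hahn) u * hcoeff f v)"
      by (rule hcoeff_times_superset)
         (auto simp: wfp_on_hsupp[unfolded hsupp_def] wfp_on_singleton hsupp_def one_hahn_def hmonom.rep_eq)
    also have "{(u, v). u \<in> {0} \<and> v \<in> hsupp f \<and> u + v = e} = (if e \<in> hsupp f then {(0, e)} else {})"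
      by auto
    finally show "hcoeff (1 * f) e = hcoeff f e"
      by (auto simp: one_hahn_def hmonom.rep_eq not_in_hsupp split: if_splits)
  qed
  show "(f + g) * h = f * h + g * h"
  proof (rule hahn_eqI)
    fix e
    let ?A = "hsupp f \<union> hsupp g"
    have wf: "wfp_on ?A (<)" by (intro wfp_on_less_Un wfp_on_hsupp)
    have sub: "hsupp (f + g) \<subseteq> ?A" by (auto simp: hsupp_def plus_hahn.rep_eq)
    show "hcoeff ((f + g) * h) e = hcoeff (f * h + g * h) e"
      unfolding plus_hahn.rep_eq
        hcoeff_times_superset[OF wf wfp_on_hsupp sub order.refl]
        hcoeff_times_superset[OF wf wfp_on_hsupp Un_upper1 order.refl]
        hcoeff_times_superset[OF wf wfp_on_hsupp Un_upper2 order.refl]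
      by (simp add: sum.distrib[symmetric] distrib_right case_prod_beta)
  qed
  show "(0::('a, 'b) hahn) \<noteq> 1"
  proof
    assume "(0::('a, 'b) hahn) = 1"
    then have "hcoeff (0::('a, 'b) hahn) 0 = hcoeff (1::('a, 'b) hahn) 0" by simp
    then show False by (simp add: zero_hahn.rep_eq one_hahn_def hmonom.rep_eq)
  qed
qed

end

lemma hmonom_mult:
  fixes a b :: "'a::comm_ring_1" and u v :: "'g::linordered_ab_group_add"
  shows "hmonom a u * hmonom b v = hmonom (a * b) (u + v)"
proof (rule hahn_eqI)
  fix e
  have "hcoeff (hmonom a u * hmonom b v) e
      = (\<Sum>(u', v') | u' \<in> {u} \<and> v' \<in> {v} \<and> u' + v' = e.
           hcoeff (hmonom a u) u' * hcoeff (hmonom b v) v')"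
    by (rule hcoeff_times_superset) (auto simp: wfp_on_def hsupp_def hmonom.rep_eq)
  also have "{(u', v'). u' \<in> {u} \<and> v' \<in> {v} \<and> u' + v' = e} = (if e = u + v then {(u, v)} else {})"
    by auto
  finally show "hcoeff (hmonom a u * hmonom b v) e = hcoeff (hmonom (a * b) (u + v)) e"
    by (simp add: hmonom.rep_eq)
qed

lemma hmonom_1_power: "hmonom (1::'a::comm_ring_1) u ^ n = hmonom 1 (\<Sum>i<n. u)"
  by (induction n) (simp_all add: one_hahn_def hmonom_mult add.commute)

lemma wfp_on_support_if:
  "wfp_on {e. (if wfp_on {e. S e \<noteq> 0} (<) then S else (\<lambda>_. 0)) e \<noteq> 0} (<)"
proof (cases "wfp_on {e. S e \<noteq> 0} (<)")
  case True
  then show ?thesis by simp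
next
  case False
  have "wfp_on {} (<)" by (simp add: wfp_on_def)
  then show ?thesis using False by simp
qed

text \<open>
  \<open>hsubst f U V\<close> is the infinite sum of \<open>f a c \<cdot> U\<^sup>a V\<^sup>c\<close> over all \<open>a\<close> and \<open>c\<close>. It is only
  meaningful if each exponent receives finitely many contributions and the resulting support is
  well-ordered (otherwise the value is 0); the lemma below shows that this is the case whenever
  \<open>U\<close> and \<open>V\<close> are monomials with positive exponents, as in all uses here.
\<close>

lift_definition hsubst :: "(nat \<Rightarrow> nat \<Rightarrow> 'a::comm_ring_1) \<Rightarrow>
    ('g::linordered_ab_group_add, 'a) hahn \<Rightarrow> ('g, 'a) hahn \<Rightarrow> ('g, 'a) hahn" is
  "\<lambda>f U V. let S = \<lambda>e. \<Sum>(a, c) | hcoeff (U ^ a * V ^ c) e \<noteq> 0. f a c * hcoeff (U ^ a * V ^ c) e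
     in if wfp_on {e. S e \<noteq> 0} (<) then S else (\<lambda>_. 0)"
  unfolding Let_def by (rule wfp_on_support_if)

lemma wfp_on_less_multiples:
  fixes u :: "'g::linordered_ab_group_add"
  assumes "u > 0"
  shows "wfp_on (range (\<lambda>n::nat. \<Sum>i<n. u)) (<)"
    and "inj (\<lambda>n::nat. \<Sum>i<n. u)"
proof -
  have sm: "strict_mono (\<lambda>n::nat. \<Sum>i<n. u)"
    using assms by (simp add: strict_mono_Suc_iff)
  show "wfp_on (range (\<lambda>n::nat. \<Sum>i<n. u)) (<)"
    unfolding wfp_on_image using strict_mono_less[OF sm] by simp
  show "inj (\<lambda>n::nat. \<Sum>i<n. u)"
    using sm by (rule strict_mono_imp_inj_on)
qed

lemma hcoeff_hsubst_hmonom: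
  fixes u v :: "'g::linordered_ab_group_add" and f :: "nat \<Rightarrow> nat \<Rightarrow> 'a::comm_ring_1"
  assumes u: "u > 0" and v: "v > 0"
  shows "finite {(a::nat, c::nat). (\<Sum>i<a. u) + (\<Sum>i<c. v) = e}" (is "finite (?D e)")
    and "hcoeff (hsubst f (hmonom 1 u) (hmonom 1 v)) e =
           (\<Sum>(a, c) | (\<Sum>i<a. u) + (\<Sum>i<c. v) = e. f a c)"
proof -
  let ?p = "\<lambda>a::nat. \<Sum>i<a. u" and ?q = "\<lambda>c::nat. \<Sum>i<c. v"
  note wf = wfp_on_less_multiples(1)[OF u] wfp_on_less_multiples(1)[OF v]
  have "finite (map_prod ?p ?q -` {(s, t). s \<in> range ?p \<and> t \<in> range ?q \<and> s + t = e})"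
    by (rule finite_vimageI[OF finite_sum_decompositions[OF wf]])
       (intro prod.inj_map wfp_on_less_multiples u v)
  also have "map_prod ?p ?q -` {(s, t). s \<in> range ?p \<and> t \<in> range ?q \<and> s + t = e} = ?D e"
    by auto
  finally show "finite (?D e)" .
  define S where "S = (\<lambda>e. \<Sum>(a, c)\<in>?D e. f a c)"
  have mono: "hcoeff (hmonom (1::'a) u ^ a * hmonom 1 v ^ c) e = (if e = ?p a + ?q c then 1 else 0)"
    for a c e by (simp add: hmonom_1_power hmonom_mult hmonom.rep_eq)
  have D: "{(a, c). hcoeff (hmonom (1::'a) u ^ a * hmonom 1 v ^ c) e \<noteq> 0} = ?D e" for e
    by (auto simp: mono split: if_splits)
  have "(\<Sum>(a, c) | hcoeff (hmonom (1::'a) u ^ a * hmonom 1 v ^ c) e \<noteq> 0.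
      f a c * hcoeff (hmonom 1 u ^ a * hmonom 1 v ^ c) e) = S e" for e
    unfolding D S_def by (rule sum.cong) (auto simp: mono)
  moreover have "wfp_on {e. S e \<noteq> 0} (<)"
  proof (rule wfp_on_subset[OF wfp_on_less_sumset[OF wf]], rule)
    fix e assume "e \<in> {e. S e \<noteq> 0}"
    then have "?D e \<noteq> {}" unfolding S_def by (intro notI) simp
    then show "e \<in> {s + t |s t. s \<in> range ?p \<and> t \<in> range ?q}" by auto
  qed
  ultimately show "hcoeff (hsubst f (hmonom 1 u) (hmonom 1 v)) e = (\<Sum>(a, c)\<in>?D e. f a c)"
    unfolding hsubst.rep_eq Let_def by (simp add: S_def)
qed

text \<open>
  Exponents are finitely supported integer vectors. Coordinate \<open>2 i\<close> belongs to \<open>x\<^sub>i\<close> and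
  coordinate \<open>2 i + 1\<close> to \<open>z\<^sub>i\<close>, where \<open>x\<^sub>0\<close> and \<open>z\<^sub>0\<close> stand for \<open>x\<close> and \<open>z\<close>.
  The order on exponents is lexicographic, coordinate 0 being the most significant; hence the
  exponents of \<open>X\<close>, \<open>Z\<close>, \<open>x/x\<^sub>i\<close> and \<open>z/z\<^sub>i\<close> are all positive.
\<close>

type_synonym laurent = "(nat \<Rightarrow>\<^sub>0 int, real) hahn"

definition x_idx :: "nat \<Rightarrow> nat" where "x_idx i = 2 * i"
definition z_idx :: "nat \<Rightarrow> nat" where "z_idx i = 2 * i + 1"

definition xv :: "nat \<Rightarrow> laurent" where "xv i = hmonom 1 (Poly_Mapping.single (x_idx i) 1)"
definition zv :: "nat \<Rightarrow> laurent" where "zv i = hmonom 1 (Poly_Mapping.single (z_idx i) 1)"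
definition xinv :: "nat \<Rightarrow> laurent" where "xinv i = hmonom 1 (Poly_Mapping.single (x_idx i) (-1))"
definition zinv :: "nat \<Rightarrow> laurent" where "zinv i = hmonom 1 (Poly_Mapping.single (z_idx i) (-1))"

lemma xv_xinv: "xv i * xinv i = 1" and zv_zinv: "zv i * zinv i = 1"
  by (simp_all add: xv_def xinv_def zv_def zinv_def hmonom_mult one_hahn_def
        flip: Poly_Mapping.single_add)

text \<open>
  The normalized integral over the unit circles of the variables in \<open>V\<close>: the coefficient of
  \<open>\<Prod>k\<in>V. k\<^sup>-\<^sup>1\<close>, as a series in the remaining variables.
\<close>

lift_definition residue_in :: "nat set \<Rightarrow> laurent \<Rightarrow> laurent" is
  "\<lambda>V f e. if \<forall>k\<in>V. Poly_Mapping.lookup e k = 0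
     then f (e - (\<Sum>k\<in>V. Poly_Mapping.single k 1)) else 0"
proof -
  fix V :: "nat set" and f :: "(nat \<Rightarrow>\<^sub>0 int) \<Rightarrow> real"
  assume f: "wfp_on {e. f e \<noteq> 0} (<)"
  let ?d = "\<Sum>k\<in>V. Poly_Mapping.single k (1::int)"
  have "wfp_on {?d} (<)" by (auto simp: wfp_on_def)
  from wfp_on_less_sumset[OF this f]
  show "wfp_on {e. (if \<forall>k\<in>V. Poly_Mapping.lookup e k = 0 then f (e - ?d) else 0) \<noteq> 0} (<)"
  proof (rule wfp_on_subset, intro subsetI)
    fix e
    assume "e \<in> {e. (if \<forall>k\<in>V. Poly_Mapping.lookup e k = 0 then f (e - ?d) else 0) \<noteq> 0}"
    then have "f (e - ?d) \<noteq> 0" by (auto split: if_splits)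
    moreover have "e = ?d + (e - ?d)" by simp
    ultimately show "e \<in> {u + v |u v. u \<in> {?d} \<and> v \<in> {e. f e \<noteq> 0}}" by blast
  qed
qed

lemma exponents_pos:
  assumes "i \<ge> 1"
  shows "0 < Poly_Mapping.single (x_idx 0) (1::int) + Poly_Mapping.single (x_idx i) (-1)"
    and "0 < Poly_Mapping.single (z_idx 0) (1::int) + Poly_Mapping.single (z_idx i) (-1)"
proof -
  show "0 < Poly_Mapping.single (x_idx 0) (1::int) + Poly_Mapping.single (x_idx i) (-1)"
    unfolding less_poly_mapping.rep_eq less_fun_def using assms
    by (intro exI[of _ "x_idx 0"]) (auto simp: lookup_add lookup_single x_idx_def when_def)
  show "0 < Poly_Mapping.single (z_idx 0) (1::int) + Poly_Mapping.single (z_idx i) (-1)"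
    unfolding less_poly_mapping.rep_eq less_fun_def using assms
    by (intro exI[of _ "z_idx 0"]) (auto simp: lookup_add lookup_single z_idx_def when_def)
qed

lemma exponents_pos_single: "0 < Poly_Mapping.single (k::nat) (1::int)"
  unfolding less_poly_mapping.rep_eq less_fun_def
  by (intro exI[of _ k]) (auto simp: lookup_single when_def)

definition contour_vars :: "nat \<Rightarrow> nat set" where
  "contour_vars b = x_idx ` {2..b} \<union> z_idx ` {2..b}"


section \<open>The generating functions\<close>

definition F_series :: "nat \<Rightarrow> nat \<Rightarrow> nat \<Rightarrow> laurent \<Rightarrow> laurent \<Rightarrow> laurent" where
  "F_series \<alpha> \<beta> \<gamma> =
     hsubst (\<lambda>a c. mzv_reg (replicate a \<alpha> @ [\<beta>] @ replicate c \<gamma>))"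

text \<open>
  The sum defining \<open>\<Phi>\<^sub>b(x,z)\<close> is a power series in \<open>x\<^sup>b\<^sup>-\<^sup>1\<close> and \<open>z\<^sup>b\<^sup>-\<^sup>1\<close>.
\<close>

definition Phi_series :: "nat \<Rightarrow> nat \<Rightarrow> nat \<Rightarrow> nat \<Rightarrow> laurent \<Rightarrow> laurent \<Rightarrow> laurent" where
  "Phi_series \<alpha> \<beta> \<gamma> b x z =
     x ^ (b * (b - 1) div 2) * z ^ ((b - 1) * (b - 2) div 2) *
     hsubst (\<lambda>a c. Rect \<alpha> \<beta> \<gamma> a (a + b + c) b) (x ^ (b - 1)) (z ^ (b - 1))"

end

theory Submission
  imports Defs "HOL-Real_Asymp.Real_Asymp" "Jordan_Normal_Form.Determinant"
begin

text \<open>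
  The truncated sums satisfy a dual Jacobi--Trudi formula, because the entries equal to \<open>M\<close> form a
  horizontal strip, and removing them matches expanding the determinant along the recursion
  \<open>E\<^sub>M(s,t) = E\<^sub>M\<^sub>-\<^sub>1(s,t) + w\<^sub>M(t+1) E\<^sub>M\<^sub>-\<^sub>1(s,t+1)\<close> of its entries. Passing to constant terms of the
  asymptotic polynomials, which is a ring homomorphism, gives
  \<open>R\<^sup>(\<^sup>a\<^sup>) = det (f(a+i, c+b-1-j))\<close> with \<open>0 \<le> i, j < b\<close>, where \<open>f(a,c)\<close> are the coefficients of \<open>F\<close>.
  In the integrand, put \<open>x\<^sub>1 = x/X\<close>. Then \<open>Xx\<^sub>i - x = X(x\<^sub>i - x\<^sub>1)\<close> completes the product to a full
  Vandermonde determinant, and in each of its terms the residue forces the indices of the \<open>b\<close> factors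
  \<open>F\<close> to be \<open>(a + \<sigma> i, c + b - 1 - i)\<close> for common \<open>a, c\<close>, so that the sum over \<open>\<sigma>\<close> is the same
  determinant.
\<close>

section \<open>Asymptotic polynomials\<close>

text \<open>\<open>asymp_poly\<close> is a definite description, so its value at 0 carries
  information only once existence is known. For multiple zeta values existence comes from
  integrating a difference equation in M; for rectangles it is not derived from tableaux at all but
  inherited from the determinant.

  Removing the largest entries of a rectangle leaves shapes that are no longer rectangles. The
  determinant formula is therefore proved by induction for all shapes, with arbitrary weights
  depending on entry and content, and specialised at the end.

  On the other side only one Vandermonde product is available. It permutes the indices belonging to
  x, while the unsymmetric powers \<open>z_i^(-i)\<close> force the indices belonging to z to
  descend by one from factor to factor. The product of the b copies of F is kept as a family of
  monomials indexed by the choice of one term in every factor, with finitely many choices for each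
  exponent; taking the residue then means solving linear equations for these choices.\<close>

abbreviation log_err :: "nat \<Rightarrow> nat \<Rightarrow> real" where
  "log_err J \<equiv> \<lambda>M. ln (real M) ^ J / real M"

definition has_asymp_poly :: "(nat \<Rightarrow> real) \<Rightarrow> real poly \<Rightarrow> bool" where
  "has_asymp_poly s P \<longleftrightarrow> (\<exists>J::nat. J > 0 \<and>
     (\<lambda>M. s M - poly P (ln (real M) + euler_mascheroni)) \<in> O(log_err J))"

lemma ln_power_mono_bigo:
  assumes "i \<le> j"
  shows "(\<lambda>M::nat. ln (real M) ^ i) \<in> O(\<lambda>M. ln (real M) ^ j)"
proof (rule bigoI[where c = 1])
  have "eventually (\<lambda>M::nat. ln (real M) \<ge> 1) at_top" by real_asymp
  then show "eventually (\<lambda>M::nat. norm (ln (real M) ^ i) \<le> 1 * norm (ln (real M) ^ j)) at_top"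
    by eventually_elim (use assms in \<open>auto simp: power_abs intro!: power_increasing\<close>)
qed

lemma log_err_mono: "i \<le> j \<Longrightarrow> log_err i \<in> O(log_err j)"
  using landau_o.big.mult[OF ln_power_mono_bigo, of i j "\<lambda>M. inverse (real M)" "\<lambda>M. inverse (real M)"]
  by (simp add: field_simps)

lemma bigo_log_err_tendsto_0:
  assumes "f \<in> O(log_err J)"
  shows "f \<longlonglongrightarrow> 0"
proof -
  have "((\<lambda>x::real. ln x ^ J / exp (ln x)) \<longlongrightarrow> 0) at_top"
    by (rule filterlim_compose[OF tendsto_power_div_exp_0 ln_at_top])
  then have "((\<lambda>x::real. ln x ^ J / x) \<longlongrightarrow> 0) at_top"
    by (rule Lim_transform_eventually) (use eventually_gt_at_top[of 0] in eventually_elim, simp)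
  then have "log_err J \<longlonglongrightarrow> 0"
    by (rule filterlim_compose) (rule filterlim_real_sequentially)
  then have "log_err J \<in> o(\<lambda>_. 1)"
    by (intro smalloI_tendsto) auto
  then have "f \<in> o(\<lambda>_. 1)" by (rule landau_o.big_small_trans[OF assms])
  then show ?thesis using smalloD_tendsto by fastforce
qed

lemma bigo_log_err_imp_bigo_1: "f \<in> O(log_err J) \<Longrightarrow> f \<in> O(\<lambda>_. 1)"
  by (drule bigo_log_err_tendsto_0) (intro bigoI_tendsto[where c = 0], auto)

lemma poly_log_bigo:
  "\<exists>J. (\<lambda>M::nat. poly P (ln (real M) + c)) \<in> O(\<lambda>M. ln (real M) ^ J)"
proof (induction P)
  case 0
  then show ?case by auto
next
  case (pCons a P)
  then obtain J where J: "(\<lambda>M::nat. poly P (ln (real M) + c)) \<in> O(\<lambda>M. ln (real M) ^ J)" by blast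
  have "(\<lambda>M::nat. ln (real M) + c) \<in> O(\<lambda>M. ln (real M))" by real_asymp
  from landau_o.big.mult[OF this J]
  have 1: "(\<lambda>M::nat. (ln (real M) + c) * poly P (ln (real M) + c)) \<in> O(\<lambda>M. ln (real M) ^ Suc J)"
    by simp
  have 2: "(\<lambda>M::nat. a) \<in> O(\<lambda>M. ln (real M) ^ Suc J)"
    by (rule landau_o.big_trans[OF _ ln_power_mono_bigo[of 0 "Suc J"]]) auto
  show ?case using sum_in_bigo(1)[OF 2 1] by (intro exI[of _ "Suc J"]) simp
qed

text \<open>A nonconstant polynomial is unbounded along an argument tending to infinity, and a
  constant one equals its limit. Uniqueness of the asymptotic polynomial rests on this.\<close>

lemma poly_tendsto_0_at_top_imp_0:
  fixes P :: "real poly"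
  assumes "filterlim f at_top F" "F \<noteq> bot" "((\<lambda>x. poly P (f x)) \<longlongrightarrow> 0) F"
  shows "P = 0"
proof (rule ccontr)
  assume P: "P \<noteq> 0"
  have lim: "filterlim f at_infinity F"
    using assms(1) by (rule filterlim_mono[OF _ at_top_le_at_infinity order.refl])
  show False
  proof (cases "degree P = 0")
    case True
    then obtain c where c: "P = [:c:]" by (metis degree_eq_zeroE)
    then have "((\<lambda>x. c) \<longlongrightarrow> 0) F" using assms(3) by simp
    then have "c = 0" using assms(2) tendsto_const_iff by metis
    then show False using P c by simp
  next
    case False
    have "filterlim (\<lambda>x. poly P (f x)) at_infinity F"
      by (rule filterlim_compose[OF filterlim_poly_at_infinity lim]) (use False in auto)
    then show False using not_tendsto_and_filterlim_at_infinity[OF assms(2,3)] by blast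
  qed
qed

lemma has_asymp_poly_unique:
  assumes "has_asymp_poly s P" "has_asymp_poly s Q"
  shows "P = Q"
proof -
  obtain J where J: "(\<lambda>M. s M - poly P (ln (real M) + euler_mascheroni)) \<in> O(log_err J)"
    using assms(1) unfolding has_asymp_poly_def by blast
  obtain K where K: "(\<lambda>M. s M - poly Q (ln (real M) + euler_mascheroni)) \<in> O(log_err K)"
    using assms(2) unfolding has_asymp_poly_def by blast
  have "(\<lambda>M::nat. poly (P - Q) (ln (real M) + euler_mascheroni)) \<longlonglongrightarrow> 0"
    using tendsto_diff[OF bigo_log_err_tendsto_0[OF K] bigo_log_err_tendsto_0[OF J]]
    by (simp add: algebra_simps)
  moreover have "filterlim (\<lambda>M::nat. ln (real M) + euler_mascheroni) at_top at_top"
    by real_asymp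
  ultimately have "P - Q = 0" by (intro poly_tendsto_0_at_top_imp_0) auto
  then show ?thesis by simp
qed

lemma asymp_poly_eqI:
  assumes "has_asymp_poly s P"
  shows "asymp_poly s = P"
  unfolding asymp_poly_def has_asymp_poly_def[symmetric]
  using assms has_asymp_poly_unique by blast

lemma has_asymp_poly_I:
  assumes "(\<lambda>M. s M - poly P (ln (real M) + euler_mascheroni)) \<in> O(log_err J)"
  shows "has_asymp_poly s P"
  unfolding has_asymp_poly_def
  by (rule exI[of _ "Suc J"]) (use landau_o.big_trans[OF assms log_err_mono[of J "Suc J"]] in auto)

lemma has_asymp_poly_const: "has_asymp_poly (\<lambda>_. c) [:c:]"
  by (rule has_asymp_poly_I[where J = 0]) simp

lemma has_asymp_poly_add:
  assumes "has_asymp_poly s P" "has_asymp_poly t Q"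
  shows "has_asymp_poly (\<lambda>M. s M + t M) (P + Q)"
proof -
  let ?L = "\<lambda>M::nat. ln (real M) + euler_mascheroni"
  obtain J where J: "(\<lambda>M. s M - poly P (?L M)) \<in> O(log_err J)"
    using assms(1) unfolding has_asymp_poly_def by blast
  obtain K where K: "(\<lambda>M. t M - poly Q (?L M)) \<in> O(log_err K)"
    using assms(2) unfolding has_asymp_poly_def by blast
  have "(\<lambda>M. (s M - poly P (?L M)) + (t M - poly Q (?L M))) \<in> O(log_err (max J K))"
    by (intro sum_in_bigo landau_o.big_trans[OF J log_err_mono] landau_o.big_trans[OF K log_err_mono]) auto
  then show ?thesis by (intro has_asymp_poly_I[where J = "max J K"]) (simp add: algebra_simps)
qed

text \<open>The cross terms multiply an error by a polynomial in log M and thus raise the power of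
  the logarithm; since J is left free, they are still admissible errors.\<close>

lemma has_asymp_poly_mult:
  assumes "has_asymp_poly s P" "has_asymp_poly t Q"
  shows "has_asymp_poly (\<lambda>M. s M * t M) (P * Q)"
proof -
  let ?L = "\<lambda>M::nat. ln (real M) + euler_mascheroni"
  obtain J where J: "(\<lambda>M. s M - poly P (?L M)) \<in> O(log_err J)"
    using assms(1) unfolding has_asymp_poly_def by blast
  obtain K where K: "(\<lambda>M. t M - poly Q (?L M)) \<in> O(log_err K)"
    using assms(2) unfolding has_asymp_poly_def by blast
  obtain I where I: "(\<lambda>M. poly P (?L M)) \<in> O(\<lambda>M. ln (real M) ^ I)" using poly_log_bigo by blast
  obtain H where H: "(\<lambda>M. poly Q (?L M)) \<in> O(\<lambda>M. ln (real M) ^ H)" using poly_log_bigo by blast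
  let ?N = "max (max J K + max I H) J"
  have 1: "(\<lambda>M. poly P (?L M) * (t M - poly Q (?L M))) \<in> O(log_err (I + K))"
    using landau_o.big.mult[OF I K] by (simp add: power_add)
  have 2: "(\<lambda>M. (s M - poly P (?L M)) * poly Q (?L M)) \<in> O(log_err (J + H))"
    using landau_o.big.mult[OF J H] by (simp add: power_add)
  have "(\<lambda>M. t M - poly Q (?L M)) \<in> O(\<lambda>_. 1)"
    by (rule bigo_log_err_imp_bigo_1[OF K])
  then have 3: "(\<lambda>M. (s M - poly P (?L M)) * (t M - poly Q (?L M))) \<in> O(log_err J)"
    using landau_o.big.mult[OF J, of _ "\<lambda>_. 1"] by simp
  have "(\<lambda>M. (poly P (?L M) * (t M - poly Q (?L M)) + (s M - poly P (?L M)) * poly Q (?L M)) +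
       (s M - poly P (?L M)) * (t M - poly Q (?L M))) \<in> O(log_err ?N)"
    by (intro sum_in_bigo landau_o.big_trans[OF 1 log_err_mono] landau_o.big_trans[OF 2 log_err_mono]
        landau_o.big_trans[OF 3 log_err_mono]) auto
  then show ?thesis by (intro has_asymp_poly_I[where J = ?N]) (simp add: algebra_simps)
qed

lemma has_asymp_poly_sum:
  "(\<And>i. i \<in> A \<Longrightarrow> has_asymp_poly (s i) (P i)) \<Longrightarrow>
     has_asymp_poly (\<lambda>M. \<Sum>i\<in>A. s i M) (\<Sum>i\<in>A. P i)"
  by (induction A rule: infinite_finite_induct)
     (use has_asymp_poly_const[of 0] in \<open>auto intro!: has_asymp_poly_add\<close>)

lemma has_asymp_poly_prod:
  "(\<And>i. i \<in> A \<Longrightarrow> has_asymp_poly (s i) (P i)) \<Longrightarrow>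
     has_asymp_poly (\<lambda>M. \<Prod>i\<in>A. s i M) (\<Prod>i\<in>A. P i)"
  by (induction A rule: infinite_finite_induct)
     (use has_asymp_poly_const[of 1] in \<open>auto intro!: has_asymp_poly_mult simp: one_pCons\<close>)

section \<open>Summation of difference equations with logarithmic increments\<close>

definition log_err2 :: "nat \<Rightarrow> nat \<Rightarrow> real" where
  "log_err2 J = (\<lambda>M. ln (real M) ^ J / real M ^ 2)"

lemma log_err2_mono: "i \<le> j \<Longrightarrow> log_err2 i \<in> O(log_err2 j)"
  unfolding log_err2_def
  using landau_o.big.mult[OF ln_power_mono_bigo, of i j "\<lambda>M. inverse (real M ^ 2)" "\<lambda>M. inverse (real M ^ 2)"]
  by (simp add: field_simps)

text \<open>A first-order Taylor expansion: log(M+1) - log M is 1/(M+1) + O(1/M^2), and the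
  remainder costs only powers of log M. The factor 1/(M+1) is the one in the recursion of the
  truncated sums.\<close>

lemma poly_log_difference:
  defines "L \<equiv> \<lambda>M::nat. ln (real M) + euler_mascheroni"
  shows "\<exists>J. (\<lambda>M. poly Q (L (Suc M)) - poly Q (L M) - poly (pderiv Q) (L M) / real (Suc M)) \<in> O(log_err2 J)"
proof (induction Q)
  case 0
  then show ?case by (auto intro: exI[of _ 0])
next
  case (pCons a R)
  define y d where "y = L" and "d = (\<lambda>M. L (Suc M) - L M)"
  define E where "E = (\<lambda>M. poly R (y M + d M) - poly R (y M) - poly (pderiv R) (y M) / real (Suc M))"
  obtain J where J: "E \<in> O(log_err2 J)"
    using pCons.IH unfolding E_def y_def d_def by auto
  obtain I where I: "(\<lambda>M. poly (pderiv R) (y M)) \<in> O(\<lambda>M. ln (real M) ^ I)"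
    using poly_log_bigo unfolding y_def L_def by blast
  obtain H where H: "(\<lambda>M. poly R (y M)) \<in> O(\<lambda>M. ln (real M) ^ H)"
    using poly_log_bigo unfolding y_def L_def by blast
  have d1: "d \<in> O(\<lambda>M. 1 / real M)" unfolding d_def L_def by real_asymp
  have d0: "d \<in> O(\<lambda>M. 1)" unfolding d_def L_def by real_asymp
  have d2: "(\<lambda>M. d M - 1 / real (Suc M)) \<in> O(\<lambda>M. 1 / real M ^ 2)" unfolding d_def L_def by real_asymp
  have y1: "y \<in> O(\<lambda>M. ln (real M))" unfolding y_def L_def by real_asymp
  have i1: "(\<lambda>M. 1 / real (Suc M)) \<in> O(\<lambda>M. 1 / real M)" by real_asymp
  \<comment> \<open>For the polynomial a + y R the error is
    \<open>y * E + d * E + d * R'(y) / (M+1) + (d - 1/(M+1)) * R(y)\<close>; the four estimates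
    below treat one summand each.\<close>
  let ?N = "max (Suc J) (max I H)"
  have 1: "(\<lambda>M. y M * E M) \<in> O(log_err2 ?N)"
  proof (rule landau_o.big_trans[OF _ log_err2_mono])
    show "(\<lambda>M. y M * E M) \<in> O(log_err2 (Suc J))"
      using landau_o.big.mult[OF y1 J] by (simp add: log_err2_def)
  qed simp
  have 2: "(\<lambda>M. d M * E M) \<in> O(log_err2 ?N)"
  proof (rule landau_o.big_trans[OF _ log_err2_mono])
    show "(\<lambda>M. d M * E M) \<in> O(log_err2 J)"
      using landau_o.big.mult[OF d0 J] by (simp add: log_err2_def)
  qed simp
  have 3: "(\<lambda>M. d M * (poly (pderiv R) (y M) * (1 / real (Suc M)))) \<in> O(log_err2 ?N)"
  proof (rule landau_o.big_trans[OF _ log_err2_mono])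
    show "(\<lambda>M. d M * (poly (pderiv R) (y M) * (1 / real (Suc M)))) \<in> O(log_err2 I)"
      using landau_o.big.mult[OF d1 landau_o.big.mult[OF I i1]] by (simp add: log_err2_def power2_eq_square)
  qed simp
  have 4: "(\<lambda>M. (d M - 1 / real (Suc M)) * poly R (y M)) \<in> O(log_err2 ?N)"
  proof (rule landau_o.big_trans[OF _ log_err2_mono])
    show "(\<lambda>M. (d M - 1 / real (Suc M)) * poly R (y M)) \<in> O(log_err2 H)"
      using landau_o.big.mult[OF d2 H] by (simp add: log_err2_def)
  qed simp
  have "(\<lambda>M. y M * E M + d M * E M + d M * (poly (pderiv R) (y M) * (1 / real (Suc M)))
      + (d M - 1 / real (Suc M)) * poly R (y M)) \<in> O(log_err2 ?N)"
    by (intro sum_in_bigo 1 2 3 4)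
  moreover have "L (Suc M) = y M + d M" "L M = y M" for M by (simp_all add: y_def d_def)
  ultimately show ?case
    by (intro exI[of _ ?N]) (simp add: pderiv_pCons E_def algebra_simps add_divide_distrib diff_divide_distrib)
qed

lemma exists_pderiv_eq:
  fixes P :: "real poly"
  obtains Q where "pderiv Q = P"
proof
  have "pderiv (\<Sum>i\<le>degree P. monom (coeff P i / real (Suc i)) (Suc i)) =
      (\<Sum>i\<le>degree P. monom (coeff P i) i)"
  proof -
    have "pderiv (\<Sum>i\<in>A. f i) = (\<Sum>i\<in>A. pderiv (f i))" for A :: "nat set" and f :: "nat \<Rightarrow> real poly"
      by (induction A rule: infinite_finite_induct) (auto simp: pderiv_add)
    then show ?thesis by (simp add: pderiv_monom del: of_nat_Suc)
  qed
  then show "pderiv (\<Sum>i\<le>degree P. monom (coeff P i / real (Suc i)) (Suc i)) = P"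
    by (simp add: poly_as_sum_of_monoms)
qed

text \<open>Comparison with a telescoping series: up to sign and a constant, the decrements of
  \<open>log_err J\<close> dominate \<open>log_err2 J\<close>, so the tail of the summed increments
  is bounded by a multiple of \<open>log_err J\<close> itself.\<close>

lemma converges_at_log_err_rate:
  fixes r :: "nat \<Rightarrow> real"
  assumes "(\<lambda>M. r (Suc M) - r M) \<in> O(log_err2 J)"
  obtains c where "(\<lambda>M. r M - c) \<in> O(log_err J)"
proof -
  define h where "h = log_err J"
  \<comment> \<open>The derivative of -(log x)^J / x is (log x)^J / x^2 minus a term with one
    logarithm less; the factor 2 leaves room for that term.\<close>
  have tel: "eventually (\<lambda>M::nat. ln (real M) ^ J / real M ^ 2 \<le> 2 * (h M - h (Suc M))) at_top"
    unfolding h_def by real_asymp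
  have pos: "eventually (\<lambda>M::nat. ln (real M) > 0) at_top" by real_asymp
  obtain C where C: "C > 0" "eventually (\<lambda>M. norm (r (Suc M) - r M) \<le> C * norm (log_err2 J M)) at_top"
    using assms by (elim landau_o.bigE)
  have "eventually (\<lambda>M. norm (r (Suc M) - r M) \<le> 2 * C * (h M - h (Suc M)) \<and> h M \<ge> 0) at_top"
    using tel pos C(2)
  proof eventually_elim
    case (elim M)
    have "norm (log_err2 J M) = ln (real M) ^ J / real M ^ 2" using elim(2) by (simp add: log_err2_def)
    with elim(1) C(1) have "C * norm (log_err2 J M) \<le> C * (2 * (h M - h (Suc M)))"
      by (intro mult_left_mono) auto
    note order.trans[OF elim(3) this]
    then show ?case using elim(2) by (simp add: h_def algebra_simps)
  qed
  then obtain N where N: "\<And>M. M \<ge> N \<Longrightarrow> norm (r (Suc M) - r M) \<le> 2 * C * (h M - h (Suc M))"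
    "\<And>M. M \<ge> N \<Longrightarrow> h M \<ge> 0"
    unfolding eventually_sequentially by blast
  have bound: "norm (r n - r m) \<le> 2 * C * h m" if "N \<le> m" "m \<le> n" for m n
  proof -
    have "norm (r n - r m) \<le> 2 * C * (h m - h n)"
      using that(2)
    proof (induction n rule: dec_induct)
      case (step n)
      have "norm (r (Suc n) - r m) \<le> norm (r (Suc n) - r n) + norm (r n - r m)"
        using norm_triangle_ineq[of "r (Suc n) - r n" "r n - r m"] by simp
      also have "\<dots> \<le> 2 * C * (h n - h (Suc n)) + 2 * C * (h m - h n)"
        using N(1)[of n] step that(1) by (intro add_mono) auto
      finally show ?case by (simp add: algebra_simps)
    qed simp
    also have "\<dots> \<le> 2 * C * h m" using N(2)[of n] that C(1) by (intro mult_left_mono) auto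
    finally show ?thesis .
  qed
  have h0: "h \<longlonglongrightarrow> 0" unfolding h_def by (rule bigo_log_err_tendsto_0[of _ J]) simp
  have "Cauchy r"
  proof (rule CauchyI')
    fix e :: real assume "e > 0"
    then have "eventually (\<lambda>m. h m < e / (2 * C)) at_top"
      using C(1) by (intro order_tendstoD(2)[OF h0]) auto
    then obtain K where K: "\<And>m. m \<ge> K \<Longrightarrow> h m < e / (2 * C)" unfolding eventually_sequentially by blast
    show "\<exists>M. \<forall>m\<ge>M. \<forall>n>m. dist (r m) (r n) < e"
    proof (intro exI allI impI)
      fix m n assume mn: "max N K \<le> m" "m < n"
      have "dist (r m) (r n) = norm (r n - r m)" by (simp add: dist_norm norm_minus_commute)
      also have "\<dots> \<le> 2 * C * h m" using mn by (intro bound) auto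
      also have "\<dots> < e" using K[of m] mn C(1) by (simp add: field_simps)
      finally show "dist (r m) (r n) < e" .
    qed
  qed
  then obtain c where c: "r \<longlonglongrightarrow> c" using Cauchy_convergent convergent_def by blast
  have "norm (c - r m) \<le> 2 * C * h m" if "m \<ge> N" for m
  proof (rule tendsto_upperbound)
    show "(\<lambda>n. norm (r n - r m)) \<longlonglongrightarrow> norm (c - r m)" by (intro tendsto_intros c)
    show "eventually (\<lambda>n. norm (r n - r m) \<le> 2 * C * h m) at_top"
      using eventually_ge_at_top[of m] by eventually_elim (use bound that in auto)
  qed simp
  then have "norm (r m - c) \<le> 2 * C * norm (h m)" if "m \<ge> N" for m
    using N(2)[OF that] that by (simp add: abs_minus_commute)
  then have "(\<lambda>M. r M - c) \<in> O(h)"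
    by (intro bigoI[where c = "2 * C"] eventually_sequentiallyI[of N])
  then show thesis unfolding h_def by (rule that)
qed

text \<open>Discrete integration: with an antiderivative Q of P, subtracting Q at log M plus Euler's
  constant leaves increments of second order. The limit of the remainder is added to Q as a
  constant.\<close>

lemma has_asymp_poly_from_difference:
  fixes s :: "nat \<Rightarrow> real"
  assumes "(\<lambda>M. s (Suc M) - s M - poly P (ln (real M) + euler_mascheroni) / real (Suc M)) \<in> O(log_err2 J)"
  shows "\<exists>Q. has_asymp_poly s Q"
proof -
  define L where "L = (\<lambda>M::nat. ln (real M) + euler_mascheroni)"
  obtain Q where Q: "pderiv Q = P" by (rule exists_pderiv_eq)
  obtain K where K: "(\<lambda>M. poly Q (L (Suc M)) - poly Q (L M) - poly P (L M) / real (Suc M)) \<in> O(log_err2 K)"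
    using poly_log_difference[of Q] unfolding Q L_def by blast
  have "(\<lambda>M. (s (Suc M) - s M - poly P (L M) / real (Suc M)) -
      (poly Q (L (Suc M)) - poly Q (L M) - poly P (L M) / real (Suc M))) \<in> O(log_err2 (max J K))"
    by (rule sum_in_bigo(2)[OF landau_o.big_trans[OF _ log_err2_mono] landau_o.big_trans[OF K log_err2_mono]])
       (use assms in \<open>auto simp: L_def\<close>)
  then have "(\<lambda>M. (s (Suc M) - poly Q (L (Suc M))) - (s M - poly Q (L M))) \<in> O(log_err2 (max J K))"
    by (simp add: algebra_simps)
  then obtain c where "(\<lambda>M. (s M - poly Q (L M)) - c) \<in> O(log_err (max J K))"
    by (rule converges_at_log_err_rate)
  then have "has_asymp_poly s (Q + [:c:])"
    by (intro has_asymp_poly_I[where J = "max J K"]) (simp add: algebra_simps L_def)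
  then show ?thesis by blast
qed

section \<open>Difference equation and asymptotics of truncated multiple zeta values\<close>

definition incr_lists :: "nat \<Rightarrow> nat \<Rightarrow> nat list set" where
  "incr_lists n M = {m. length m = n \<and> set m \<subseteq> {1..M} \<and> sorted_wrt (<) m}"

lemma finite_incr_lists: "finite (incr_lists n M)"
  by (rule finite_subset[OF _ finite_lists_length_eq[of "{1..M}" n]]) (auto simp: incr_lists_def)

lemma incr_lists_0: "incr_lists 0 M = {[]}"
  by (auto simp: incr_lists_def)

lemma incr_lists_Suc_0: "incr_lists (Suc n) 0 = {}"
  by (auto simp: incr_lists_def)

lemma incr_lists_Suc:
  "incr_lists (Suc n) (Suc M) = incr_lists (Suc n) M \<union> (\<lambda>m. m @ [Suc M]) ` incr_lists n M"
proof (intro equalityI subsetI)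
  fix m assume m: "m \<in> incr_lists (Suc n) (Suc M)"
  then obtain l a where la: "m = l @ [a]" unfolding incr_lists_def by (cases m rule: rev_cases) auto
  have l: "length l = n" "set l \<subseteq> {1..Suc M}" "1 \<le> a" "a \<le> Suc M" "sorted_wrt (<) l" "\<forall>x\<in>set l. x < a"
    using m unfolding la incr_lists_def by (simp_all add: sorted_wrt_append)
  show "m \<in> incr_lists (Suc n) M \<union> (\<lambda>m. m @ [Suc M]) ` incr_lists n M"
  proof (cases "a = Suc M")
    case True
    then have "\<forall>x\<in>set l. x \<in> {1..M}" using l(2,6) by fastforce
    then have "l \<in> incr_lists n M" using l(1,5) unfolding incr_lists_def by blast
    then show ?thesis using True la by blast
  next
    case False
    then have "a \<le> M" using l(4) by simp
    then have "\<forall>x\<in>set l. x \<in> {1..M}" using l(2,6) by fastforce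
    then have "m \<in> incr_lists (Suc n) M"
      using l \<open>a \<le> M\<close> unfolding la incr_lists_def by (simp add: sorted_wrt_append subset_iff)
    then show ?thesis by blast
  qed
next
  fix m assume "m \<in> incr_lists (Suc n) M \<union> (\<lambda>m. m @ [Suc M]) ` incr_lists n M"
  then show "m \<in> incr_lists (Suc n) (Suc M)"
  proof
    assume "m \<in> (\<lambda>m. m @ [Suc M]) ` incr_lists n M"
    then obtain l where l: "m = l @ [Suc M]" "length l = n" "set l \<subseteq> {1..M}" "sorted_wrt (<) l"
      unfolding incr_lists_def by blast
    then have "\<forall>x\<in>set l. x < Suc M" by auto
    then show ?thesis using l unfolding incr_lists_def by (auto simp: sorted_wrt_append)
  qed (auto simp: incr_lists_def)
qed

lemma mzv_trunc_eq:
  "mzv_trunc k M = (\<Sum>m\<in>incr_lists (length k) M. \<Prod>i<length k. 1 / real (m ! i) ^ (k ! i))"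
  by (simp add: mzv_trunc_def incr_lists_def)

lemma mzv_trunc_Nil [simp]: "mzv_trunc [] M = 1"
  by (simp add: mzv_trunc_eq incr_lists_0)

lemma mzv_trunc_snoc_0: "mzv_trunc (k @ [n]) 0 = 0"
  by (simp add: mzv_trunc_eq incr_lists_Suc_0)

text \<open>The last summation variable is the largest and either equals M + 1 or does not. This
  equation serves twice: it yields the asymptotics, and it is the recursion required of the
  determinant entries.\<close>

lemma mzv_trunc_snoc_Suc:
  "mzv_trunc (k @ [n]) (Suc M) = mzv_trunc (k @ [n]) M + mzv_trunc k M / real (Suc M) ^ n"
proof -
  let ?w = "\<lambda>k m. \<Prod>i<length k. 1 / real (m ! i) ^ (k ! i)"
  let ?I = "(\<lambda>m. m @ [Suc M]) ` incr_lists (length k) M"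
  have inj: "inj_on (\<lambda>m. m @ [Suc M]) (incr_lists (length k) M)" by (auto intro: inj_onI)
  have disj: "incr_lists (Suc (length k)) M \<inter> ?I = {}" by (auto simp: incr_lists_def)
  have "mzv_trunc (k @ [n]) (Suc M) = (\<Sum>m\<in>incr_lists (Suc (length k)) M \<union> ?I. ?w (k @ [n]) m)"
    by (simp only: mzv_trunc_eq incr_lists_Suc length_append_singleton)
  also have "\<dots> = (\<Sum>m\<in>incr_lists (Suc (length k)) M. ?w (k @ [n]) m) + (\<Sum>m\<in>?I. ?w (k @ [n]) m)"
    by (rule sum.union_disjoint[OF finite_incr_lists finite_imageI[OF finite_incr_lists] disj])
  also have "(\<Sum>m\<in>incr_lists (Suc (length k)) M. ?w (k @ [n]) m) = mzv_trunc (k @ [n]) M"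
    by (simp only: mzv_trunc_eq length_append_singleton)
  also have "(\<Sum>m\<in>?I. ?w (k @ [n]) m) = (\<Sum>m\<in>incr_lists (length k) M. ?w k m / real (Suc M) ^ n)"
    unfolding sum.reindex[OF inj]
  proof (rule sum.cong[OF refl])
    fix m assume "m \<in> incr_lists (length k) M"
    then have "length m = length k" by (simp add: incr_lists_def)
    then show "(?w (k @ [n]) \<circ> (\<lambda>m. m @ [Suc M])) m = ?w k m / real (Suc M) ^ n"
      by (simp add: nth_append del: of_nat_Suc)
  qed
  finally show ?thesis by (simp add: mzv_trunc_eq sum_divide_distrib)
qed

lemma has_asymp_poly_imp_bigo:
  assumes "has_asymp_poly s P"
  shows "\<exists>H. s \<in> O(\<lambda>M. ln (real M) ^ H)"
proof -
  define p where "p = (\<lambda>M::nat. poly P (ln (real M) + euler_mascheroni))"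
  obtain J where J: "(\<lambda>M. s M - p M) \<in> O(log_err J)"
    using assms unfolding has_asymp_poly_def p_def by blast
  obtain H where H: "p \<in> O(\<lambda>M. ln (real M) ^ H)"
    using poly_log_bigo unfolding p_def by blast
  have 0: "(\<lambda>M. s M - p M) \<in> O(\<lambda>_. 1)"
    by (rule bigo_log_err_imp_bigo_1[OF J])
  have 1: "(\<lambda>_. 1) \<in> O(\<lambda>M::nat. ln (real M) ^ H)"
    using ln_power_mono_bigo[of 0 H] by simp
  have "(\<lambda>M. (s M - p M) + p M) \<in> O(\<lambda>M. ln (real M) ^ H)"
    by (rule sum_in_bigo(1)[OF landau_o.big_trans[OF 0 1] H])
  then show ?thesis by auto
qed

lemma inverse_power_Suc_bigo:
  assumes "n \<ge> k"
  shows "(\<lambda>M. 1 / real (Suc M) ^ n) \<in> O(\<lambda>M. 1 / real M ^ k)"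
proof -
  have "norm (1 / real (Suc M) ^ n) \<le> 1 * norm (1 / real M ^ k)" if "M > 0" for M
  proof -
    have "real M ^ k \<le> real (Suc M) ^ k" by (intro power_mono) auto
    also have "\<dots> \<le> real (Suc M) ^ n" using assms by (intro power_increasing) auto
    finally have "1 / real (Suc M) ^ n \<le> 1 / real M ^ k" using that by (intro frac_le) auto
    then show ?thesis by simp
  qed
  then show ?thesis
    by (intro bigoI[where c = 1] eventually_mono[OF eventually_gt_at_top[of 0]])
qed

text \<open>Induction by dropping the last index n. For n = 1 the increment is, to second order, the
  polynomial of the shorter list divided by M + 1, which is integrated; for n \<ge> 2 the increment
  is itself of second order. With a last index 0 it would not decay.\<close>

lemma has_asymp_poly_mzv_trunc:
  assumes "\<forall>n\<in>set k. n \<ge> 1"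
  shows "has_asymp_poly (mzv_trunc k) (asymp_poly (mzv_trunc k))"
proof -
  have "\<exists>P. has_asymp_poly (mzv_trunc k) P"
    using assms
  proof (induction k rule: rev_induct)
    case Nil
    then show ?case using has_asymp_poly_const[of 1] by auto
  next
    case (snoc n k)
    then obtain P where P: "has_asymp_poly (mzv_trunc k) P" by auto
    then obtain J where J: "(\<lambda>M. mzv_trunc k M - poly P (ln (real M) + euler_mascheroni)) \<in> O(log_err J)"
      unfolding has_asymp_poly_def by blast
    have "\<exists>Q. has_asymp_poly (mzv_trunc (k @ [n])) Q"
    proof (cases "n = 1")
      case True
      have "(\<lambda>M. 1 / real (Suc M)) \<in> O(\<lambda>M. 1 / real M)" by real_asymp
      from landau_o.big.mult[OF J this]
      have "(\<lambda>M. (mzv_trunc k M - poly P (ln (real M) + euler_mascheroni)) * (1 / real (Suc M))) \<in> O(log_err2 J)"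
        by (simp add: log_err2_def power2_eq_square)
      then have "(\<lambda>M. mzv_trunc (k @ [n]) (Suc M) - mzv_trunc (k @ [n]) M -
          poly P (ln (real M) + euler_mascheroni) / real (Suc M)) \<in> O(log_err2 J)"
        by (simp add: mzv_trunc_snoc_Suc True diff_divide_distrib)
      then show ?thesis by (rule has_asymp_poly_from_difference)
    next
      case False
      moreover have "n \<ge> 1" using snoc.prems by simp
      ultimately have "n \<ge> 2" by linarith
      have inv: "(\<lambda>M. 1 / real (Suc M) ^ n) \<in> O(\<lambda>M. 1 / real M ^ 2)"
        using \<open>n \<ge> 2\<close> by (rule inverse_power_Suc_bigo)
      obtain H where "mzv_trunc k \<in> O(\<lambda>M. ln (real M) ^ H)"
        using has_asymp_poly_imp_bigo[OF P] by blast
      from landau_o.big.mult[OF this inv]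
      have "(\<lambda>M. mzv_trunc k M * (1 / real (Suc M) ^ n)) \<in> O(log_err2 H)" by (simp add: log_err2_def)
      moreover have "(\<lambda>M. mzv_trunc k M * (1 / real (Suc M) ^ n)) =
          (\<lambda>M. mzv_trunc (k @ [n]) (Suc M) - mzv_trunc (k @ [n]) M -
             poly 0 (ln (real M) + euler_mascheroni) / real (Suc M))"
        by (simp add: fun_eq_iff mzv_trunc_snoc_Suc)
      ultimately have "(\<lambda>M. mzv_trunc (k @ [n]) (Suc M) - mzv_trunc (k @ [n]) M -
          poly 0 (ln (real M) + euler_mascheroni) / real (Suc M)) \<in> O(log_err2 H)"
        by metis
      then show ?thesis
        by (rule has_asymp_poly_from_difference[where s = "mzv_trunc (k @ [n])" and P = 0 and J = H])
    qed
    then show ?case .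
  qed
  then show ?thesis using asymp_poly_eqI by blast
qed

section \<open>Determinants of indexed families\<close>

text \<open>Multiplication by the unipotent \<open>U\<close> subtracts \<open>y n\<close> times each
  column from the next one, which clears the last row except for its first entry. Laplace expansion
  along that row and extracting \<open>y i - y n\<close> from the other rows leave the determinant
  of size n.\<close>

lemma det_vandermonde:
  fixes y :: "nat \<Rightarrow> 'a::comm_ring_1"
  shows "det (mat n n (\<lambda>(i, j). y i ^ j)) = (\<Prod>j<n. \<Prod>i<j. y j - y i)"
proof (induction n)
  case 0
  then show ?case by simp
next
  case (Suc n)
  define A where "A = mat (Suc n) (Suc n) (\<lambda>(i, j). y i ^ j)"
  define U where "U = mat (Suc n) (Suc n)
    (\<lambda>(i, j). if i = j then 1 else if Suc i = j then - y n else 0)"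
  define B where "B = mat (Suc n) (Suc n) (\<lambda>(i, j). if j = 0 then 1 else y i ^ (j - 1) * (y i - y n))"
  have [simp]: "A \<in> carrier_mat (Suc n) (Suc n)" "U \<in> carrier_mat (Suc n) (Suc n)"
    "B \<in> carrier_mat (Suc n) (Suc n)" by (auto simp: A_def U_def B_def)
  have "det U = prod_list (diag_mat U)"
    by (rule det_upper_triangular[where n = "Suc n"]) (auto simp: U_def upper_triangular_def)
  also have "diag_mat U = map (\<lambda>_. 1) [0..<Suc n]"
    unfolding diag_mat_def by (rule map_cong) (auto simp: U_def)
  also have "prod_list \<dots> = (1::'a)" by (simp add: map_replicate_const)
  finally have detU: "det U = 1" .
  have AU: "A * U = B"
  proof (rule eq_matI)
    fix i j assume ij: "i < dim_row B" "j < dim_col B"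
    then have ij': "i < Suc n" "j < Suc n" by (auto simp: B_def)
    have "(A * U) $$ (i, j) = (\<Sum>k = 0..<Suc n. y i ^ k * (if k = j then 1 else if Suc k = j then - y n else 0))"
      using ij' by (simp add: A_def U_def scalar_prod_def)
    also have "\<dots> = (\<Sum>k \<in> {0..<Suc n}. if k = j then y i ^ k else 0) +
        (\<Sum>k \<in> {0..<Suc n}. if Suc k = j then - y n * y i ^ k else 0)"
      by (subst sum.distrib[symmetric], rule sum.cong) auto
    also have "\<dots> = B $$ (i, j)"
      using ij' by (cases j) (auto simp: B_def algebra_simps, metis Suc_lessI power_Suc)
    finally show "(A * U) $$ (i, j) = B $$ (i, j)" .
  qed (auto simp: A_def U_def B_def)
  have "det A = det (A * U)" by (simp add: det_mult[where n = "Suc n"] detU)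
  also have "\<dots> = (\<Sum>j<Suc n. B $$ (n, j) * cofactor B n j)"
    unfolding AU by (rule laplace_expansion_row) auto
  also have "\<dots> = (\<Sum>j<Suc n. if j = 0 then cofactor B n 0 else 0)"
    by (rule sum.cong) (auto simp: B_def)
  also have "\<dots> = cofactor B n 0" by simp
  also have "\<dots> = (- 1) ^ n * det (mat_delete B n 0)" by (simp add: cofactor_def)
  also have "mat_delete B n 0 = mat\<^sub>r n n (\<lambda>i. (y i - y n) \<cdot>\<^sub>v vec n (\<lambda>j. y i ^ j))"
    by (rule eq_matI) (auto simp: mat_delete_def B_def)
  also have "det \<dots> = (\<Prod>i = 0..<n. y i - y n) * det (mat\<^sub>r n n (\<lambda>i. vec n (\<lambda>j. y i ^ j)))"
    by (rule det_rows_mul) auto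
  also have "mat\<^sub>r n n (\<lambda>i. vec n (\<lambda>j. y i ^ j)) = mat n n (\<lambda>(i, j). y i ^ j)"
    by (rule eq_matI) auto
  also have "(- 1) ^ n * ((\<Prod>i = 0..<n. y i - y n) * det (mat n n (\<lambda>(i, j). y i ^ j))) =
     (\<Prod>i<n. y n - y i) * det (mat n n (\<lambda>(i, j). y i ^ j))"
  proof -
    have "(\<Prod>i<n. y n - y i) = (\<Prod>i<n. (- 1) * (y i - y n))" by simp
    also have "\<dots> = (- 1) ^ n * (\<Prod>i<n. y i - y n)"
      by (simp only: prod.distrib prod_constant card_lessThan)
    finally show ?thesis by (simp add: lessThan_atLeast0 mult.assoc)
  qed
  finally show ?case unfolding A_def Suc.IH by simp
qed

text \<open>The Leibniz formula for a function of two indices, so that columns can be altered by a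
  conditional and M can stay a parameter of the entries. The permutation acts on the first
  index.\<close>

definition det_fn :: "nat \<Rightarrow> (nat \<Rightarrow> nat \<Rightarrow> 'a::comm_ring_1) \<Rightarrow> 'a" where
  "det_fn n A = (\<Sum>p | p permutes {..<n}. of_int (sign p) * (\<Prod>j<n. A (p j) j))"

lemma det_fn_eq_det: "det_fn n A = det (mat n n (\<lambda>(i, j). A i j))"
proof -
  have "(\<Prod>j<n. A (p j) j) = (\<Prod>j<n. mat n n (\<lambda>(i, j). A i j) $$ (p j, j))" if "p permutes {..<n}" for p
    using permutes_in_image[OF that] by (intro prod.cong) auto
  then show ?thesis
    unfolding det_fn_def by (subst det_col[where n = n]) (auto simp: lessThan_atLeast0 intro!: sum.cong)
qed

text \<open>Transposing puts the permutation into the exponents and keeps the nodes in their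
  order.\<close>

lemma vandermonde_leibniz:
  fixes y :: "nat \<Rightarrow> 'a::comm_ring_1"
  shows "(\<Prod>j<n. \<Prod>i<j. y j - y i) = (\<Sum>p | p permutes {..<n}. of_int (sign p) * (\<Prod>i<n. y i ^ p i))"
proof -
  have "(\<Prod>j<n. \<Prod>i<j. y j - y i) = det (mat n n (\<lambda>(i, j). y i ^ j))"
    by (rule det_vandermonde[symmetric])
  also have "\<dots> = det (mat n n (\<lambda>(i, j). y j ^ i))"
    by (subst det_transpose[symmetric, where n = n]) (auto intro!: arg_cong[where f = det] eq_matI)
  also have "\<dots> = det_fn n (\<lambda>i j. y j ^ i)"
    by (rule det_fn_eq_det[symmetric])
  finally show ?thesis unfolding det_fn_def .
qed

lemma det_fn_zero_column:
  assumes "j < n" "\<And>i. i < n \<Longrightarrow> A i j = 0"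
  shows "det_fn n A = 0"
proof -
  have "(\<Prod>j<n. A (p j) j) = 0" if "p permutes {..<n}" for p
    using permutes_in_image[OF that] assms by (intro prod_zero) auto
  then show ?thesis by (simp add: det_fn_def)
qed

lemma det_fn_eq_columns:
  assumes "j < n" "k < n" "j \<noteq> k" "\<And>i. i < n \<Longrightarrow> A i j = A i k"
  shows "det_fn n A = 0"
  unfolding det_fn_eq_det
  by (rule det_identical_columns[of _ n j k]) (use assms in \<open>auto intro!: eq_vecI\<close>)

text \<open>Multilinearity in all columns at once, \<open>S\<close> being the columns in which
  \<open>B\<close> is chosen. For tableaux these become the columns that lose a cell.\<close>

lemma det_fn_add_columns:
  "det_fn n (\<lambda>i j. A i j + B i j) = (\<Sum>S\<in>Pow {..<n}. det_fn n (\<lambda>i j. if j \<in> S then B i j else A i j))"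
proof -
  have "(\<Prod>j<n. A (p j) j + B (p j) j) = (\<Sum>S\<in>Pow {..<n}. \<Prod>j<n. if j \<in> S then B (p j) j else A (p j) j)" for p
  proof -
    have "(\<Prod>j<n. A (p j) j + B (p j) j) = (\<Prod>j<n. B (p j) j + A (p j) j)" by (simp add: add.commute)
    also have "\<dots> = (\<Sum>S\<in>Pow {..<n}. (\<Prod>j\<in>S. B (p j) j) * (\<Prod>j\<in>{..<n} - S. A (p j) j))"
      by (rule prod_add) simp
    also have "\<dots> = (\<Sum>S\<in>Pow {..<n}. \<Prod>j<n. if j \<in> S then B (p j) j else A (p j) j)"
    proof (rule sum.cong[OF refl])
      fix S assume "S \<in> Pow {..<n}"
      then have "{..<n} \<inter> {x. x \<in> S} = S" "{..<n} \<inter> - {x. x \<in> S} = {..<n} - S" by auto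
      then show "(\<Prod>j\<in>S. B (p j) j) * (\<Prod>j\<in>{..<n} - S. A (p j) j) = (\<Prod>j<n. if j \<in> S then B (p j) j else A (p j) j)"
        by (subst prod.If_cases) auto
    qed
    finally show ?thesis .
  qed
  then show ?thesis
    unfolding det_fn_def by (simp add: sum_distrib_left sum.swap[of _ "Pow {..<n}"])
qed

lemma det_fn_scale_columns:
  "det_fn n (\<lambda>i j. c j * A i j) = (\<Prod>j<n. c j) * det_fn n A"
  by (simp add: det_fn_def prod.distrib sum_distrib_left algebra_simps)

section \<open>Column-strict tableaux and the dual Jacobi--Trudi formula\<close>

text \<open>
  A shape is given by its column lengths \<open>L\<close>, zero from some column on; rows and columns are
  numbered from 0.
\<close>

definition cells :: "(nat \<Rightarrow> nat) \<Rightarrow> (nat \<times> nat) set" where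
  "cells L = {(i, j). i < L j}"

text \<open>Monotonicity is required of all pairs in a row or column, not just of neighbours, so
  that restricting or extending a tableau needs no argument about the cells in between.\<close>

definition tabs :: "(nat \<Rightarrow> nat) \<Rightarrow> nat \<Rightarrow> (nat \<times> nat \<Rightarrow> nat) set" where
  "tabs L M = {t \<in> cells L \<rightarrow>\<^sub>E {1..M}.
     (\<forall>j i i'. i < i' \<and> i' < L j \<longrightarrow> t (i, j) < t (i', j)) \<and>
     (\<forall>i j j'. j < j' \<and> i < L j' \<longrightarrow> t (i, j) \<le> t (i, j'))}"

definition remove_strip :: "(nat \<Rightarrow> nat) \<Rightarrow> nat set \<Rightarrow> nat \<Rightarrow> nat" where
  "remove_strip L S = (\<lambda>j. if j \<in> S then L j - 1 else L j)"

text \<open>A horizontal strip: columns lose at most their bottom cell, and what remains is again a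
  shape.\<close>

definition strip :: "(nat \<Rightarrow> nat) \<Rightarrow> nat set \<Rightarrow> bool" where
  "strip L S \<longleftrightarrow> (\<forall>j\<in>S. 0 < L j) \<and> antimono (remove_strip L S)"

text \<open>Meant for \<open>m\<close> the largest admissible entry, which strictly increasing
  columns can carry only in their bottom cell.\<close>

definition top_columns :: "(nat \<Rightarrow> nat) \<Rightarrow> nat \<Rightarrow> (nat \<times> nat \<Rightarrow> nat) \<Rightarrow> nat set" where
  "top_columns L m t = {j. 0 < L j \<and> t (L j - 1, j) = m}"

definition tabs_sum :: "(nat \<Rightarrow> int \<Rightarrow> real) \<Rightarrow> int \<Rightarrow> (nat \<Rightarrow> nat) \<Rightarrow> nat \<Rightarrow> real" where
  "tabs_sum w s L M = (\<Sum>t\<in>tabs L M. \<Prod>(i, j)\<in>cells L. w (t (i, j)) (s + int j - int i))"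

lemma finite_cells:
  assumes "antimono L" "L n = 0"
  shows "finite (cells L)"
proof (rule finite_subset)
  show "cells L \<subseteq> {..<L 0} \<times> {..<n}"
  proof clarify
    fix i j assume "(i, j) \<in> cells L"
    then have ij: "i < L j" by (simp add: cells_def)
    have "L j \<le> L 0" by (rule antimonoD[OF assms(1)]) simp
    moreover have "j < n"
    proof (rule ccontr)
      assume "\<not> j < n"
      then have "L j \<le> L n" by (intro antimonoD[OF assms(1)]) simp
      then show False using ij assms(2) by simp
    qed
    ultimately show "i \<in> {..<L 0} \<and> j \<in> {..<n}" using ij by simp
  qed
qed simp

lemma finite_tabs:
  assumes "finite (cells L)"
  shows "finite (tabs L M)"
proof (rule finite_subset)
  show "tabs L M \<subseteq> cells L \<rightarrow>\<^sub>E {1..M}" by (auto simp: tabs_def)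
  show "finite (cells L \<rightarrow>\<^sub>E {1..M})" using assms by (intro finite_PiE) auto
qed

lemma tabsD:
  assumes "t \<in> tabs L M"
  shows "i < L j \<Longrightarrow> t (i, j) \<in> {1..M}"
    and "i < i' \<Longrightarrow> i' < L j \<Longrightarrow> t (i, j) < t (i', j)"
    and "j < j' \<Longrightarrow> i < L j' \<Longrightarrow> t (i, j) \<le> t (i, j')"
    and "c \<notin> cells L \<Longrightarrow> t c = undefined"
proof -
  have P: "t \<in> cells L \<rightarrow>\<^sub>E {1..M}"
    and C: "\<forall>j i i'. i < i' \<and> i' < L j \<longrightarrow> t (i, j) < t (i', j)"
    and R: "\<forall>i j j'. j < j' \<and> i < L j' \<longrightarrow> t (i, j) \<le> t (i, j')"
    using assms unfolding tabs_def mem_Collect_eq by blast+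
  show "t (i, j) \<in> {1..M}" if "i < L j"
    by (rule PiE_mem[OF P]) (use that in \<open>simp add: cells_def\<close>)
  show "t (i, j) < t (i', j)" if "i < i'" "i' < L j" using C that by simp
  show "t (i, j) \<le> t (i, j')" if "j < j'" "i < L j'" using R that by simp
  show "t c = undefined" if "c \<notin> cells L" by (rule PiE_arb[OF P that])
qed

lemma tabsI:
  assumes "\<And>i j. i < L j \<Longrightarrow> t (i, j) \<in> {1..M}"
    and "\<And>i i' j. i < i' \<Longrightarrow> i' < L j \<Longrightarrow> t (i, j) < t (i', j)"
    and "\<And>i j j'. j < j' \<Longrightarrow> i < L j' \<Longrightarrow> t (i, j) \<le> t (i, j')"
    and "\<And>c. c \<notin> cells L \<Longrightarrow> t c = undefined"
  shows "t \<in> tabs L M"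
proof -
  have "t \<in> cells L \<rightarrow>\<^sub>E {1..M}"
  proof (rule PiE_I)
    fix c assume "c \<in> cells L"
    then obtain i j where "c = (i, j)" "i < L j" by (cases c) (simp add: cells_def)
    then show "t c \<in> {1..M}" using assms(1) by simp
  qed (rule assms(4))
  moreover have "\<forall>j i i'. i < i' \<and> i' < L j \<longrightarrow> t (i, j) < t (i', j)" using assms(2) by simp
  moreover have "\<forall>i j j'. j < j' \<and> i < L j' \<longrightarrow> t (i, j) \<le> t (i, j')" using assms(3) by simp
  ultimately show ?thesis unfolding tabs_def by simp
qed

section \<open>Removing and restoring the strip of largest entries\<close>

lemma strip_top_columns:
  assumes L: "antimono L" and t: "t \<in> tabs L M"
  shows "strip L (top_columns L M t)"
  unfolding strip_def
proof
  let ?S = "top_columns L M t"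
  show "antimono (remove_strip L ?S)"
    unfolding decseq_Suc_iff
  proof
    fix j
    have le: "L (Suc j) \<le> L j" by (rule antimonoD[OF L]) simp
    show "remove_strip L ?S (Suc j) \<le> remove_strip L ?S j"
    proof (rule ccontr)
      assume *: "\<not> ?thesis"
      have j: "j \<in> ?S" "Suc j \<notin> ?S" "L (Suc j) = L j"
        using * le by (auto simp: remove_strip_def split: if_splits)
      define i where "i = L j - 1"
      have i: "i < L (Suc j)" "t (i, j) = M" using j by (auto simp: top_columns_def i_def)
      \<comment> \<open>For adjacent columns of equal length, a largest entry at the bottom of the
        left one forces one at the bottom of the right one, which therefore loses its cell
        too.\<close>
      have "t (i, j) \<le> t (i, Suc j)" by (rule tabsD(3)[OF t _ i(1)]) simp
      moreover have "t (i, Suc j) \<in> {1..M}" by (rule tabsD(1)[OF t i(1)])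
      ultimately have "t (i, Suc j) = M" using i(2) by simp
      then have "Suc j \<in> ?S" using i j(3) by (auto simp: top_columns_def i_def)
      then show False using j by simp
    qed
  qed
qed (auto simp: top_columns_def)

lemma cells_remove_strip:
  assumes "\<And>j. j \<in> S \<Longrightarrow> 0 < L j"
  shows "cells L = cells (remove_strip L S) \<union> (\<lambda>j. (L j - 1, j)) ` S"
    and "cells (remove_strip L S) \<inter> (\<lambda>j. (L j - 1, j)) ` S = {}"
proof -
  have "(i, j) \<in> cells L \<longleftrightarrow> (i, j) \<in> cells (remove_strip L S) \<or> (j \<in> S \<and> i = L j - 1)" for i j
    using assms[of j] by (auto simp: cells_def remove_strip_def)
  then show "cells L = cells (remove_strip L S) \<union> (\<lambda>j. (L j - 1, j)) ` S" by auto
  show "cells (remove_strip L S) \<inter> (\<lambda>j. (L j - 1, j)) ` S = {}"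
    by (auto simp: cells_def remove_strip_def)
qed

lemma remove_strip_le: "remove_strip L S j \<le> L j"
  by (simp add: remove_strip_def)

lemma restrict_tabs:
  assumes L: "antimono L" and t: "t \<in> tabs L (Suc M)"
  defines "L' \<equiv> remove_strip L (top_columns L (Suc M) t)"
  shows "restrict t (cells L') \<in> tabs L' M"
proof (rule tabsI)
  have sub: "i < L j" if "i < L' j" for i j
    using that remove_strip_le[of L "top_columns L (Suc M) t" j] unfolding L'_def by (rule less_le_trans)
  have L': "antimono L'" using strip_top_columns[OF L t] by (simp add: strip_def L'_def)
  have left: "i < L' j" if "j < j'" "i < L' j'" for i j j'
    using antimonoD[OF L', of j j'] that by simp
  \<comment> \<open>Only the removed cells could carry M + 1: an entry higher up is strictly below
    the bottom entry of its column.\<close>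
  have neq: "t (i, j) \<noteq> Suc M" if "i < L' j" for i j
  proof (cases "i = L j - 1")
    case True
    then show ?thesis using that by (auto simp: L'_def remove_strip_def top_columns_def split: if_splits)
  next
    case False
    then have "i < L j - 1" "L j - 1 < L j" using sub[OF that] by auto
    then show ?thesis using tabsD(2)[OF t, of i "L j - 1" j] tabsD(1)[OF t, of "L j - 1" j] by auto
  qed
  show "restrict t (cells L') (i, j) \<in> {1..M}" if "i < L' j" for i j
    using tabsD(1)[OF t sub[OF that]] neq[OF that] that by (auto simp: cells_def le_Suc_eq)
  show "restrict t (cells L') (i, j) < restrict t (cells L') (i', j)" if "i < i'" "i' < L' j" for i i' j
    using tabsD(2)[OF t, of i i' j] sub[OF that(2)] that by (simp add: cells_def)
  show "restrict t (cells L') (i, j) \<le> restrict t (cells L') (i, j')" if "j < j'" "i < L' j'" for i j j'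
    using tabsD(3)[OF t, of j j' i] sub[OF that(2)] that left[OF that] by (simp add: cells_def)
qed simp

definition add_strip :: "(nat \<Rightarrow> nat) \<Rightarrow> nat set \<Rightarrow> nat \<Rightarrow> (nat \<times> nat \<Rightarrow> nat) \<Rightarrow> nat \<times> nat \<Rightarrow> nat" where
  "add_strip L S m u = (\<lambda>c. if c \<in> cells (remove_strip L S) then u c
     else if c \<in> cells L then m else undefined)"

lemma add_strip_tabs:
  assumes L: "antimono L" and S: "strip L S" and u: "u \<in> tabs (remove_strip L S) M"
  shows "add_strip L S (Suc M) u \<in> tabs L (Suc M)"
proof (rule tabsI)
  define L' where "L' = remove_strip L S"
  have L': "antimono L'" and pos: "\<And>j. j \<in> S \<Longrightarrow> 0 < L j" using S by (simp_all add: strip_def L'_def)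
  note u' = tabsD[OF u, folded L'_def]
  have val: "add_strip L S (Suc M) u (i, j) = (if i < L' j then u (i, j) else Suc M)" if "i < L j" for i j
    using that by (simp add: add_strip_def cells_def L'_def)
  have u1: "u (i, j) < Suc M" "1 \<le> u (i, j)" if "i < L' j" for i j using u'(1)[OF that] by auto
  show "add_strip L S (Suc M) u (i, j) \<in> {1..Suc M}" if "i < L j" for i j
    using u1[of i j] by (auto simp: val[OF that])
  show "add_strip L S (Suc M) u (i, j) < add_strip L S (Suc M) u (i', j)" if "i < i'" "i' < L j" for i i' j
  proof -
    \<comment> \<open>A cell with another cell below it is not removed, so its entry comes from
      \<open>u\<close> and is at most M.\<close>
    have "i < L' j" using that by (auto simp: L'_def remove_strip_def)
    then show ?thesis using u'(2)[of i i' j] u1[of i j] that by (simp add: val)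
  qed
  show "add_strip L S (Suc M) u (i, j) \<le> add_strip L S (Suc M) u (i, j')" if "j < j'" "i < L j'" for i j j'
  proof -
    have ij: "i < L j" using that antimonoD[OF L, of j j'] by simp
    show ?thesis
    proof (cases "i < L' j'")
      case True
      then have "i < L' j" using antimonoD[OF L', of j j'] that(1) by simp
      then show ?thesis using True u'(3)[of j j' i] that ij by (simp add: val)
    next
      case False
      then show ?thesis using u1(1)[of i j] that ij by (auto simp: val)
    qed
  qed
  show "add_strip L S (Suc M) u c = undefined" if "c \<notin> cells L" for c
  proof -
    have "c \<notin> cells L'" using that remove_strip_le[of L S] unfolding L'_def cells_def
      by (cases c) (auto dest: less_le_trans)
    then show ?thesis using that by (simp add: add_strip_def L'_def)
  qed
qed

lemma top_columns_add_strip: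
  assumes "strip L S" "u \<in> tabs (remove_strip L S) M"
  shows "top_columns L (Suc M) (add_strip L S (Suc M) u) = S"
proof -
  have "0 < L j \<and> add_strip L S (Suc M) u (L j - 1, j) = Suc M \<longleftrightarrow> j \<in> S" for j
  proof (cases "0 < L j")
    case True
    have "u (L j - 1, j) \<in> {1..M}" if "j \<notin> S"
      by (rule tabsD(1)[OF assms(2)]) (use True that in \<open>simp add: remove_strip_def\<close>)
    then show ?thesis using True by (auto simp: add_strip_def cells_def remove_strip_def)
  next
    case False
    then show ?thesis using assms(1) by (auto simp: strip_def)
  qed
  then show ?thesis by (auto simp: top_columns_def)
qed

lemma add_strip_restrict:
  assumes t: "t \<in> tabs L (Suc M)"
  defines "S \<equiv> top_columns L (Suc M) t"
  shows "add_strip L S (Suc M) (restrict t (cells (remove_strip L S))) = t"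
proof
  fix c :: "nat \<times> nat"
  obtain i j where c: "c = (i, j)" by (cases c)
  show "add_strip L S (Suc M) (restrict t (cells (remove_strip L S))) c = t c"
  proof (cases "i < L j \<and> \<not> i < remove_strip L S j")
    case True
    then have "j \<in> S" "i = L j - 1" by (auto simp: remove_strip_def split: if_splits)
    then have "t (i, j) = Suc M" by (simp add: S_def top_columns_def)
    then show ?thesis using True by (simp add: c add_strip_def cells_def)
  next
    case False
    then show ?thesis using tabsD(4)[OF t, of c] by (auto simp: c add_strip_def cells_def)
  qed
qed

lemma restrict_add_strip:
  assumes "u \<in> tabs (remove_strip L S) M"
  shows "restrict (add_strip L S m u) (cells (remove_strip L S)) = u"
proof
  fix c show "restrict (add_strip L S m u) (cells (remove_strip L S)) c = u c"
    using tabsD(4)[OF assms, of c] by (simp add: add_strip_def restrict_def)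
qed

text \<open>Tableaux are grouped by the strip filled with M + 1; within a group, deleting the strip
  is a bijection onto the tableaux of the smaller shape with entries at most M. The bottom cell of
  column j lies in row L j - 1, whence the shifted content s + j - L j + 1.\<close>

lemma tabs_sum_Suc:
  assumes L: "antimono L" "L n = 0"
  shows "tabs_sum w s L (Suc M) = (\<Sum>S | S \<subseteq> {..<n} \<and> strip L S.
    (\<Prod>j\<in>S. w (Suc M) (s + int j - int (L j) + 1)) * tabs_sum w s (remove_strip L S) M)"
proof -
  let ?W = "\<lambda>L t. \<Prod>(i, j)\<in>cells L. w (t (i, j)) (s + int j - int i)"
  let ?A = "{S. S \<subseteq> {..<n} \<and> strip L S}"
  let ?top = "top_columns L (Suc M)"
  note fin = finite_cells[OF L]
  have sub: "?top ` tabs L (Suc M) \<subseteq> ?A"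
  proof (rule image_subsetI)
    fix t assume t: "t \<in> tabs L (Suc M)"
    have "?top t \<subseteq> {..<n}"
    proof
      fix j assume "j \<in> ?top t"
      then have "0 < L j" by (simp add: top_columns_def)
      then show "j \<in> {..<n}" using antimonoD[OF L(1), of n j] L(2) by (cases "n \<le> j") auto
    qed
    then show "?top t \<in> ?A" using strip_top_columns[OF L(1) t] by simp
  qed
  have "tabs_sum w s L (Suc M) = (\<Sum>S\<in>?A. \<Sum>t | t \<in> tabs L (Suc M) \<and> ?top t = S. ?W L t)"
    unfolding tabs_sum_def
    by (rule sum.group[OF finite_tabs[OF fin] _ sub, symmetric]) (rule finite_subset[of _ "Pow {..<n}"], auto)
  also have "\<dots> = (\<Sum>S\<in>?A. (\<Prod>j\<in>S. w (Suc M) (s + int j - int (L j) + 1)) * tabs_sum w s (remove_strip L S) M)"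
  proof (rule sum.cong[OF refl])
    fix S assume "S \<in> ?A"
    then have S: "S \<subseteq> {..<n}" "strip L S" by auto
    then have pos: "\<And>j. j \<in> S \<Longrightarrow> 0 < L j" by (simp add: strip_def)
    let ?L' = "remove_strip L S"
    let ?I = "(\<lambda>j. (L j - 1, j)) ` S"
    have cells: "cells L = cells ?L' \<union> ?I" "cells ?L' \<inter> ?I = {}"
      by (rule cells_remove_strip, erule pos)+
    have fin': "finite (cells ?L')" "finite ?I"
      using fin cells(1) finite_Un by metis+
    have "(\<Sum>t | t \<in> tabs L (Suc M) \<and> ?top t = S. ?W L t) =
        (\<Sum>u\<in>tabs ?L' M. (\<Prod>j\<in>S. w (Suc M) (s + int j - int (L j) + 1)) * ?W ?L' u)"
    proof (rule sum.reindex_bij_witness[of _ "add_strip L S (Suc M)" "\<lambda>t. restrict t (cells ?L')"])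
      fix t assume "t \<in> {t \<in> tabs L (Suc M). ?top t = S}"
      then have t: "t \<in> tabs L (Suc M)" "?top t = S" by auto
      show "add_strip L S (Suc M) (restrict t (cells ?L')) = t"
        using add_strip_restrict[OF t(1)] t(2) by simp
      show "restrict t (cells ?L') \<in> tabs ?L' M"
        using restrict_tabs[OF L(1) t(1)] t(2) by simp
      have "?W L t = (\<Prod>(i, j)\<in>cells ?L'. w (t (i, j)) (s + int j - int i)) *
          (\<Prod>(i, j)\<in>?I. w (t (i, j)) (s + int j - int i))"
        using prod.union_disjoint[OF fin'(1) fin'(2) cells(2), of "\<lambda>(i, j). w (t (i, j)) (s + int j - int i)"]
        unfolding cells(1)[symmetric] .
      also have "(\<Prod>(i, j)\<in>cells ?L'. w (t (i, j)) (s + int j - int i)) = ?W ?L' (restrict t (cells ?L'))"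
        by (rule prod.cong) auto
      also have "(\<Prod>(i, j)\<in>?I. w (t (i, j)) (s + int j - int i)) =
          (\<Prod>j\<in>S. w (t (L j - 1, j)) (s + int j - int (L j - 1)))"
        by (subst prod.reindex) (auto intro: inj_onI)
      also have "\<dots> = (\<Prod>j\<in>S. w (Suc M) (s + int j - int (L j) + 1))"
      proof (rule prod.cong[OF refl])
        fix j assume "j \<in> S"
        then have "t (L j - 1, j) = Suc M" "0 < L j" using t(2) by (auto simp: top_columns_def)
        then show "w (t (L j - 1, j)) (s + int j - int (L j - 1)) = w (Suc M) (s + int j - int (L j) + 1)"
          by (simp add: of_nat_diff algebra_simps)
      qed
      finally show "(\<Prod>j\<in>S. w (Suc M) (s + int j - int (L j) + 1)) * ?W ?L' (restrict t (cells ?L')) = ?W L t"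
        by (rule trans[OF mult.commute sym])
    next
      fix u assume u: "u \<in> tabs ?L' M"
      show "restrict (add_strip L S (Suc M) u) (cells ?L') = u" by (rule restrict_add_strip[OF u])
      show "add_strip L S (Suc M) u \<in> {t \<in> tabs L (Suc M). ?top t = S}"
        using add_strip_tabs[OF L(1) S(2) u] top_columns_add_strip[OF S(2) u] by simp
    qed
    then show "(\<Sum>t | t \<in> tabs L (Suc M) \<and> ?top t = S. ?W L t) =
        (\<Prod>j\<in>S. w (Suc M) (s + int j - int (L j) + 1)) * tabs_sum w s ?L' M"
      by (simp add: tabs_sum_def sum_distrib_left)
  qed
  finally show ?thesis .
qed

text \<open>Both ways of not being a strip, an empty column in \<open>S\<close> or a loss of
  monotonicity, lead to one local pattern, and this pattern is what makes a determinant
  degenerate.\<close>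

lemma not_strip_cases:
  assumes L: "antimono L" "L n = 0" and S: "S \<subseteq> {..<n}" "\<not> strip L S"
  obtains k where "k \<in> S" "Suc k \<notin> S" "L (Suc k) = L k"
proof (rule ccontr)
  assume "\<not> thesis"
  with that have *: "Suc k \<in> S \<or> L (Suc k) \<noteq> L k" if "k \<in> S" for k using that by blast
  have le: "L (Suc k) \<le> L k" for k by (rule antimonoD[OF L(1)]) simp
  have pos: "0 < L k" if "k \<in> S" for k
  proof (rule ccontr)
    assume "\<not> 0 < L k"
    then have 0: "L k = 0" by simp
    \<comment> \<open>Without the pattern, an empty column in \<open>S\<close> would drag all later
      columns into \<open>S\<close>, which is bounded by n.\<close>
    have "k + m \<in> S \<and> L (k + m) = 0" for m
    proof (induction m)
      case (Suc m)
      then show ?case using *[of "k + m"] le[of "k + m"] by auto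
    qed (use that 0 in auto)
    from this[of n] show False using S(1) by auto
  qed
  have "antimono (remove_strip L S)"
    unfolding decseq_Suc_iff
  proof
    fix k show "remove_strip L S (Suc k) \<le> remove_strip L S k"
      using le[of k] *[of k] pos[of k] pos[of "Suc k"] by (auto simp: remove_strip_def)
  qed
  then show False using S(2) pos by (simp add: strip_def)
qed

text \<open>
  In the expansion of the determinant, a set \<open>S\<close> of columns that is not a strip contributes a
  determinant with two equal adjacent columns, or with a vanishing last column.
\<close>

theorem tabs_sum_jacobi_trudi:
  fixes E :: "nat \<Rightarrow> int \<Rightarrow> int \<Rightarrow> real"
  assumes E0: "\<And>s t. E 0 s t = (if s = t then 1 else 0)"
    and E_Suc: "\<And>M s t. E (Suc M) s t = E M s t + w (Suc M) (t + 1) * E M s (t + 1)"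
    and L: "antimono L" "L n = 0"
  shows "tabs_sum w s L M = det_fn n (\<lambda>i j. E M (s + int i) (s + int j - int (L j)))"
  using L
proof (induction M arbitrary: L)
  case 0
  show ?case
  proof (cases "\<forall>j. L j = 0")
    case True
    have "tabs L 0 = {\<lambda>_. undefined}" using True by (auto simp: tabs_def cells_def)
    moreover have "cells L = {}" using True by (simp add: cells_def)
    moreover have "det_fn n (\<lambda>i j. E 0 (s + int i) (s + int j - int (L j))) = det (1\<^sub>m n)"
      unfolding det_fn_eq_det by (rule arg_cong[where f = det], rule eq_matI) (use True in \<open>auto simp: E0\<close>)
    ultimately show ?thesis by (simp add: tabs_sum_def)
  next
    case False
    then obtain j where j: "0 < L j" by auto
    have pos: "0 < L 0" using antimonoD[OF 0(1), of 0 j] j by simp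
    then have n: "0 < n" using 0(2) by (cases n) auto
    have "tabs L 0 = {}" using tabsD(1)[of _ L 0 0 0] pos by auto
    \<comment> \<open>Column 0 has second argument s - L 0 < s, which differs from every s +
      i.\<close>
    moreover have "det_fn n (\<lambda>i j. E 0 (s + int i) (s + int j - int (L j))) = 0"
      by (rule det_fn_zero_column[OF n]) (use pos in \<open>simp add: E0\<close>)
    ultimately show ?thesis by (simp add: tabs_sum_def)
  qed
next
  case (Suc M L)
  \<comment> \<open>The recursion only raises the second argument, so \<open>E\<close> inherits the
    triangular form of \<open>E 0\<close>.\<close>
  have Ez: "E M s t = 0" if "s < t" for s t M
    using that by (induction M arbitrary: t) (auto simp: E0 E_Suc)
  let ?t = "\<lambda>j. s + int j - int (L j)"
  let ?c = "\<lambda>j. w (Suc M) (?t j + 1)"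
  let ?B = "\<lambda>S i j. E M (s + int i) (if j \<in> S then ?t j + 1 else ?t j)"
  have "det_fn n (\<lambda>i j. E (Suc M) (s + int i) (?t j)) =
      det_fn n (\<lambda>i j. E M (s + int i) (?t j) + ?c j * E M (s + int i) (?t j + 1))"
    by (simp add: E_Suc)
  also have "\<dots> = (\<Sum>S\<in>Pow {..<n}. det_fn n (\<lambda>i j. if j \<in> S then ?c j * E M (s + int i) (?t j + 1) else E M (s + int i) (?t j)))"
    by (rule det_fn_add_columns)
  also have "\<dots> = (\<Sum>S\<in>Pow {..<n}. (\<Prod>j\<in>S. ?c j) * det_fn n (?B S))"
  proof (rule sum.cong[OF refl])
    fix S assume "S \<in> Pow {..<n}"
    then have "(\<Prod>j<n. if j \<in> S then ?c j else 1) = (\<Prod>j\<in>S. ?c j)"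
      by (simp add: prod.If_cases Int_absorb1)
    moreover have "det_fn n (\<lambda>i j. if j \<in> S then ?c j * E M (s + int i) (?t j + 1) else E M (s + int i) (?t j)) =
        det_fn n (\<lambda>i j. (if j \<in> S then ?c j else 1) * ?B S i j)"
      by (intro arg_cong[where f = "det_fn n"] ext) simp
    ultimately show "det_fn n (\<lambda>i j. if j \<in> S then ?c j * E M (s + int i) (?t j + 1) else E M (s + int i) (?t j)) =
        (\<Prod>j\<in>S. ?c j) * det_fn n (?B S)"
      by (simp only: det_fn_scale_columns)
  qed
  also have "\<dots> = (\<Sum>S | S \<subseteq> {..<n} \<and> strip L S. (\<Prod>j\<in>S. ?c j) * det_fn n (?B S))"
  proof (rule sum.mono_neutral_right)
    show "\<forall>S\<in>Pow {..<n} - {S. S \<subseteq> {..<n} \<and> strip L S}. (\<Prod>j\<in>S. ?c j) * det_fn n (?B S) = 0"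
    proof
      fix S assume "S \<in> Pow {..<n} - {S. S \<subseteq> {..<n} \<and> strip L S}"
      then have S: "S \<subseteq> {..<n}" "\<not> strip L S" by auto
      obtain k where k: "k \<in> S" "Suc k \<notin> S" "L (Suc k) = L k" by (rule not_strip_cases[OF Suc.prems S])
      have kn: "k < n" using k(1) S(1) by auto
      have "det_fn n (?B S) = 0"
      proof (cases "Suc k < n")
        case True
        \<comment> \<open>Column k is moved by one and column k + 1 is not; having equal lengths,
          both have second argument s + k - L k + 1.\<close>
        show ?thesis
          by (rule det_fn_eq_columns[OF kn True]) (use k in \<open>auto simp: algebra_simps\<close>)
      next
        case False
        then have "Suc k = n" using kn by simp
        then have "L k = 0" using k(3) Suc.prems(2) by simp
        \<comment> \<open>The moved last column has second argument s + n, above every first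
          argument s + i with i < n.\<close>
        show ?thesis
          by (rule det_fn_zero_column[OF kn]) (use k(1) \<open>L k = 0\<close> \<open>Suc k = n\<close> in \<open>auto intro!: Ez\<close>)
      qed
      then show "(\<Prod>j\<in>S. ?c j) * det_fn n (?B S) = 0" by simp
    qed
  qed auto
  also have "\<dots> = (\<Sum>S | S \<subseteq> {..<n} \<and> strip L S. (\<Prod>j\<in>S. ?c j) * tabs_sum w s (remove_strip L S) M)"
  proof (rule sum.cong[OF refl])
    fix S assume "S \<in> {S. S \<subseteq> {..<n} \<and> strip L S}"
    then have S: "strip L S" by simp
    have "tabs_sum w s (remove_strip L S) M =
        det_fn n (\<lambda>i j. E M (s + int i) (s + int j - int (remove_strip L S j)))"
      by (rule Suc.IH) (use S Suc.prems in \<open>auto simp: strip_def remove_strip_def\<close>)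
    also have "\<dots> = det_fn n (?B S)"
      by (intro arg_cong[where f = "det_fn n"] ext)
         (use S in \<open>auto simp: strip_def remove_strip_def of_nat_diff algebra_simps\<close>)
    finally show "(\<Prod>j\<in>S. ?c j) * det_fn n (?B S) = (\<Prod>j\<in>S. ?c j) * tabs_sum w s (remove_strip L S) M"
      by simp
  qed
  also have "\<dots> = tabs_sum w s L (Suc M)"
    using tabs_sum_Suc[OF Suc.prems, of w s M] by simp
  finally show ?case by simp
qed

section \<open>Rectangular shapes and the coefficients of F\<close>

lemma diagram_replicate: "diagram (replicate p q) = {1..p} \<times> {1..q}"
proof -
  have "(i, j) \<in> diagram (replicate p q) \<longleftrightarrow> (i, j) \<in> {1..p} \<times> {1..q}" for i j
  proof (cases "1 \<le> i \<and> i \<le> p")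
    case True
    then have "i - 1 < p" by linarith
    then have "replicate p q ! (i - 1) = q" by (rule List.nth_replicate)
    then show ?thesis using True by (auto simp: diagram_def)
  next
    case False
    then show ?thesis by (auto simp: diagram_def)
  qed
  then show ?thesis by auto
qed

text \<open>Inequalities between neighbours propagate to all pairs because a rectangle contains
  every cell in between.\<close>

lemma ssyt_rectangleD:
  assumes "t \<in> ssyt (replicate p q) M"
  shows "1 \<le> i \<Longrightarrow> i \<le> p \<Longrightarrow> 1 \<le> j \<Longrightarrow> j \<le> q \<Longrightarrow> t (i, j) \<in> {1..M}"
    and "1 \<le> i \<Longrightarrow> i < i' \<Longrightarrow> i' \<le> p \<Longrightarrow> 1 \<le> j \<Longrightarrow> j \<le> q \<Longrightarrow> t (i, j) < t (i', j)"
    and "1 \<le> i \<Longrightarrow> i \<le> p \<Longrightarrow> 1 \<le> j \<Longrightarrow> j \<le> j' \<Longrightarrow> j' \<le> q \<Longrightarrow> t (i, j) \<le> t (i, j')"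
    and "c \<notin> {1..p} \<times> {1..q} \<Longrightarrow> t c = undefined"
proof -
  have P: "t \<in> {1..p} \<times> {1..q} \<rightarrow>\<^sub>E {1..M}"
    and R: "\<And>i j. (i, j) \<in> {1..p} \<times> {1..q} \<Longrightarrow> (i, j + 1) \<in> {1..p} \<times> {1..q} \<Longrightarrow> t (i, j) \<le> t (i, j + 1)"
    and C: "\<And>i j. (i, j) \<in> {1..p} \<times> {1..q} \<Longrightarrow> (i + 1, j) \<in> {1..p} \<times> {1..q} \<Longrightarrow> t (i, j) < t (i + 1, j)"
    using assms unfolding ssyt_def diagram_replicate mem_Collect_eq by blast+
  show "t (i, j) \<in> {1..M}" if "1 \<le> i" "i \<le> p" "1 \<le> j" "j \<le> q"
    by (rule PiE_mem[OF P]) (use that in simp)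
  show "t c = undefined" if "c \<notin> {1..p} \<times> {1..q}" by (rule PiE_arb[OF P that])
  show "t (i, j) < t (i', j)" if "1 \<le> i" "i < i'" "i' \<le> p" "1 \<le> j" "j \<le> q"
    using that(2,3)
  proof (induction i' rule: less_induct)
    case (less i')
    obtain l where l: "i' = Suc l" using less.prems by (cases i') auto
    have last: "t (l, j) < t (i', j)" using C[of l j] less.prems that by (simp add: l)
    show ?case
    proof (cases "i = l")
      case False
      then have "t (i, j) < t (l, j)" using less l by simp
      then show ?thesis using last by simp
    qed (use last in simp)
  qed
  show "t (i, j) \<le> t (i, j')" if "1 \<le> i" "i \<le> p" "1 \<le> j" "j \<le> j'" "j' \<le> q"
    using that(4,5)
  proof (induction j' rule: dec_induct)
    case (step j')
    then show ?case using R[of i j'] that by simp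
  qed simp
qed

text \<open>Renumbering rows and columns from 0 shifts both coordinates by one and so preserves the
  content j - i.\<close>

lemma schur_mzv_trunc_rectangle:
  "schur_mzv_trunc (replicate p q) (\<lambda>(i, j). k (int j - int i + int m)) M =
     tabs_sum (\<lambda>e c. 1 / real e ^ k c) (int m) (\<lambda>j. if j < q then p else 0) M"
proof -
  let ?L = "\<lambda>j. if j < q then p else 0"
  let ?D = "{1..p} \<times> {1..q}"
  have cells: "cells ?L = {..<p} \<times> {..<q}" by (auto simp: cells_def split: if_splits)
  let ?f = "\<lambda>t. restrict (\<lambda>(i, j). t (Suc i, Suc j)) (cells ?L)"
  let ?g = "\<lambda>u. restrict (\<lambda>(i, j). u (i - 1, j - 1)) ?D"
  show ?thesis
    unfolding schur_mzv_trunc_def tabs_sum_def diagram_replicate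
  proof (rule sum.reindex_bij_witness[of _ ?g ?f])
    fix t assume t: "t \<in> ssyt (replicate p q) M"
    note t' = ssyt_rectangleD[OF t]
    show "?g (?f t) = t"
    proof
      fix c :: "nat \<times> nat"
      show "?g (?f t) c = t c"
      proof (cases "c \<in> ?D")
        case True
        then show ?thesis by (cases c) (auto simp: cells)
      qed (use t'(4)[of c] in \<open>auto simp: restrict_def\<close>)
    qed
    show "?f t \<in> tabs ?L M"
    proof (rule tabsI)
      show "?f t (i, j) \<in> {1..M}" if "i < ?L j" for i j
        using t'(1)[of "Suc i" "Suc j"] that by (simp add: cells split: if_splits)
      show "?f t (i, j) < ?f t (i', j)" if "i < i'" "i' < ?L j" for i i' j
        using t'(2)[of "Suc i" "Suc i'" "Suc j"] that by (simp add: cells split: if_splits)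
      show "?f t (i, j) \<le> ?f t (i, j')" if "j < j'" "i < ?L j'" for i j j'
        using t'(3)[of "Suc i" "Suc j" "Suc j'"] that by (simp add: cells split: if_splits)
    qed (auto simp: restrict_def)
    show "(\<Prod>(i, j)\<in>cells ?L. 1 / real (?f t (i, j)) ^ k (int m + int j - int i)) =
        (\<Prod>c\<in>?D. 1 / real (t c) ^ (case c of (i, j) \<Rightarrow> k (int j - int i + int m)))"
      by (rule prod.reindex_bij_witness[of _ "\<lambda>(i, j). (i - 1, j - 1)" "\<lambda>(i, j). (Suc i, Suc j)"])
         (auto simp: cells algebra_simps)
  next
    fix u assume u: "u \<in> tabs ?L M"
    note u' = tabsD[OF u]
    show "?f (?g u) = u"
    proof
      fix c :: "nat \<times> nat"
      show "?f (?g u) c = u c"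
      proof (cases "c \<in> cells ?L")
        case True
        then show ?thesis by (cases c) (auto simp: cells)
      qed (use u'(4)[of c] in \<open>simp add: restrict_def\<close>)
    qed
    have "?g u \<in> ?D \<rightarrow>\<^sub>E {1..M}"
    proof (rule PiE_I)
      fix c assume c: "c \<in> ?D"
      then have "u (fst c - 1, snd c - 1) \<in> {1..M}" by (intro u'(1)) auto
      then show "?g u c \<in> {1..M}" using c by (auto simp: case_prod_beta)
    qed (auto simp: restrict_def)
    moreover have "?g u (i, j) \<le> ?g u (i, j + 1)" if "(i, j) \<in> ?D" "(i, j + 1) \<in> ?D" for i j
      using u'(3)[of "j - 1" j "i - 1"] that by auto
    moreover have "?g u (i, j) < ?g u (i + 1, j)" if "(i, j) \<in> ?D" "(i + 1, j) \<in> ?D" for i j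
      using u'(2)[of "i - 1" i "j - 1"] that by auto
    ultimately show "?g u \<in> ssyt (replicate p q) M"
      unfolding ssyt_def diagram_replicate by blast
  qed
qed

text \<open>The indices read down a single column whose contents run from \<open>s\<close> to
  \<open>t + 1\<close>; the determinant entries are the truncated sums over such columns.\<close>

definition content_list :: "(int \<Rightarrow> nat) \<Rightarrow> int \<Rightarrow> int \<Rightarrow> nat list" where
  "content_list k s t = map (\<lambda>i. k (s - int i)) [0..<nat (s - t)]"

lemma content_list_snoc:
  assumes "t < s"
  shows "content_list k s t = content_list k s (t + 1) @ [k (t + 1)]"
proof -
  have "nat (s - t) = Suc (nat (s - (t + 1)))" using assms by simp
  moreover have "s - int (nat (s - (t + 1))) = t + 1" using assms by simp
  ultimately show ?thesis by (simp add: content_list_def)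
qed

lemma schur_mzv_trunc_rectangle_eq_det:
  "schur_mzv_trunc (replicate p q) (\<lambda>(i, j). k (int j - int i + int m)) M =
     det_fn q (\<lambda>i j. if int j - int p \<le> int i
       then mzv_trunc (content_list k (int m + int i) (int m + int j - int p)) M else 0)"
proof -
  \<comment> \<open>On the diagonal the list is empty and the sum is 1. For t > s the list is empty
    as well, so the value 0 has to be set explicitly.\<close>
  define E where "E = (\<lambda>M s t. if t \<le> s then mzv_trunc (content_list k s t) M else 0)"
  have Nil: "content_list k s s = []" for s by (simp add: content_list_def)
  have E0: "E 0 s t = (if s = t then 1 else 0)" for s t
    by (auto simp: E_def Nil content_list_snoc[of t s] mzv_trunc_snoc_0)
  have ESuc: "E (Suc M) s t = E M s t + 1 / real (Suc M) ^ k (t + 1) * E M s (t + 1)" for M s t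
  proof -
    consider "t < s" | "t = s" | "s < t" by linarith
    then show ?thesis
      by cases (simp_all add: E_def Nil content_list_snoc[of t s] mzv_trunc_snoc_Suc del: of_nat_Suc)
  qed
  have "tabs_sum (\<lambda>e c. 1 / real e ^ k c) (int m) (\<lambda>j. if j < q then p else 0) M =
      det_fn q (\<lambda>i j. E M (int m + int i) (int m + int j - int (if j < q then p else 0)))"
    by (rule tabs_sum_jacobi_trudi[where w = "\<lambda>e c. 1 / real e ^ k c", OF E0 ESuc])
       (auto intro!: antimonoI)
  also have "\<dots> = det_fn q (\<lambda>i j. E M (int m + int i) (int m + int j - int p))"
    unfolding det_fn_def by (intro sum.cong arg_cong2[where f = "(*)"] prod.cong refl) simp
  also have "\<dots> = det_fn q (\<lambda>i j. if int j - int p \<le> int i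
       then mzv_trunc (content_list k (int m + int i) (int m + int j - int p)) M else 0)"
    unfolding E_def by (intro arg_cong[where f = "det_fn q"] ext if_cong refl) auto
  finally show ?thesis unfolding schur_mzv_trunc_rectangle .
qed

lemma content_list_content_index:
  "content_list (content_index \<alpha> \<beta> \<gamma>) (int n) (- int r - 1) = replicate n \<alpha> @ [\<beta>] @ replicate r \<gamma>"
proof (rule nth_equalityI)
  have len: "nat (int n - (- int r - 1)) = n + Suc r" by simp
  show "length (content_list (content_index \<alpha> \<beta> \<gamma>) (int n) (- int r - 1)) =
      length (replicate n \<alpha> @ [\<beta>] @ replicate r \<gamma>)"
    by (simp add: content_list_def len)
  fix i assume "i < length (content_list (content_index \<alpha> \<beta> \<gamma>) (int n) (- int r - 1))"
  then have i: "i < n + Suc r" by (simp add: content_list_def len)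
  have "content_list (content_index \<alpha> \<beta> \<gamma>) (int n) (- int r - 1) ! i = content_index \<alpha> \<beta> \<gamma> (int n - int i)"
    using i unfolding content_list_def len by (simp del: upt_Suc)
  also have "\<dots> = (replicate n \<alpha> @ [\<beta>] @ replicate r \<gamma>) ! i"
  proof -
    consider "i < n" | "i = n" | l where "i = n + Suc l" "l < r"
      using i by (metis add_Suc_right add_less_cancel_left less_iff_Suc_add linorder_neqE_nat not_less_eq)
    then show ?thesis by cases (simp_all add: content_index_def nth_append)
  qed
  finally show "content_list (content_index \<alpha> \<beta> \<gamma>) (int n) (- int r - 1) ! i =
      (replicate n \<alpha> @ [\<beta>] @ replicate r \<gamma>) ! i" .
qed

text \<open>The height a + b + c makes the contents of entry (i, j) run from a + i down to -(c + b -
  1 - j). This range contains 0, so every entry is a coefficient of F.\<close>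

lemma Rect_eq_det:
  assumes "\<alpha> \<ge> 1" "\<beta> \<ge> 1" "\<gamma> \<ge> 1"
  shows "Rect \<alpha> \<beta> \<gamma> a (a + b + c) b =
    det_fn b (\<lambda>i j. mzv_reg (replicate (a + i) \<alpha> @ [\<beta>] @ replicate (c + b - Suc j) \<gamma>))"
proof -
  define K where "K = (\<lambda>i j. replicate (a + i) \<alpha> @ [\<beta>] @ replicate (c + b - Suc j) \<gamma>)"
  define P where "P = (\<lambda>i j. asymp_poly (mzv_trunc (K i j)))"
  have asy: "has_asymp_poly (mzv_trunc (K i j)) (P i j)" for i j
    unfolding P_def by (rule has_asymp_poly_mzv_trunc) (use assms in \<open>auto simp: K_def\<close>)
  have entry: "(if int j - int (a + b + c) \<le> int i
      then mzv_trunc (content_list (content_index \<alpha> \<beta> \<gamma>) (int a + int i) (int a + int j - int (a + b + c))) M else 0) =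
      mzv_trunc (K i j) M" if "j < b" for i j M
  proof -
    have "int a + int i = int (a + i)" "int a + int j - int (a + b + c) = - int (c + b - Suc j) - 1"
      using that by (auto simp: of_nat_diff)
    then show ?thesis using that by (simp only: content_list_content_index K_def) simp
  qed
  have "schur_mzv_trunc (replicate (a + b + c) b) (\<lambda>(i, j). content_index \<alpha> \<beta> \<gamma> (int j - int i + int a)) =
      (\<lambda>M. det_fn b (\<lambda>i j. mzv_trunc (K i j) M))"
    unfolding schur_mzv_trunc_rectangle_eq_det det_fn_def
    by (intro ext sum.cong arg_cong2[where f = "(*)"] prod.cong refl) (rule entry, simp)
  \<comment> \<open>This is where the Schur sum acquires an asymptotic polynomial; the signs enter
    as constant sequences.\<close>
  moreover have "has_asymp_poly (\<lambda>M. det_fn b (\<lambda>i j. mzv_trunc (K i j) M)) (det_fn b P)"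
    unfolding det_fn_def
    by (intro has_asymp_poly_sum has_asymp_poly_mult has_asymp_poly_prod asy)
       (metis has_asymp_poly_const of_int_poly)
  ultimately have "Rect \<alpha> \<beta> \<gamma> a (a + b + c) b = poly (det_fn b P) 0"
    by (simp add: Rect_def schur_mzv_reg_def asymp_poly_eqI)
  also have "\<dots> = det_fn b (\<lambda>i j. mzv_reg (K i j))"
    by (simp add: det_fn_def P_def mzv_reg_def poly_sum poly_prod)
  finally show ?thesis unfolding K_def .
qed

section \<open>Expansions of Hahn series\<close>

lemma hcoeff_hmonom_times:
  fixes f :: "('g::linordered_ab_group_add, 'a::comm_ring_1) hahn"
  shows "hcoeff (hmonom a u * f) e = a * hcoeff f (e - u)"
proof -
  have "hcoeff (hmonom a u * f) e = (\<Sum>(u', v) | u' \<in> {u} \<and> v \<in> hsupp f \<and> u' + v = e.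
      hcoeff (hmonom a u) u' * hcoeff f v)"
    by (rule hcoeff_times_superset) (auto simp: wfp_on_hsupp[unfolded hsupp_def] wfp_on_singleton hsupp_def hmonom.rep_eq)
  also have "{(u', v). u' \<in> {u} \<and> v \<in> hsupp f \<and> u' + v = e} =
      (if hcoeff f (e - u) \<noteq> 0 then {(u, e - u)} else {})"
    by (auto simp: hsupp_def algebra_simps)
  finally show ?thesis by (simp add: hmonom.rep_eq)
qed

lemma hcoeff_sum: "hcoeff (\<Sum>i\<in>A. f i) e = (\<Sum>i\<in>A. hcoeff (f i) e)"
  for f :: "'i \<Rightarrow> ('g::linordered_ab_group_add, 'a::comm_ring_1) hahn"
  by (induction A rule: infinite_finite_induct) (simp_all add: zero_hahn.rep_eq plus_hahn.rep_eq)

lemma of_int_hahn: "of_int n = (hmonom (of_int n) 0 :: ('g::linordered_ab_group_add, 'a::comm_ring_1) hahn)"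
proof -
  have "of_nat n = (hmonom (of_nat n) 0 :: ('g, 'a) hahn)" for n
  proof (induction n)
    case 0
    then show ?case by (intro hahn_eqI) (simp add: zero_hahn.rep_eq hmonom.rep_eq)
  next
    case (Suc n)
    then show ?case by (intro hahn_eqI) (simp add: one_hahn_def plus_hahn.rep_eq hmonom.rep_eq)
  qed
  then show ?thesis
    by (cases n) (auto intro!: hahn_eqI simp: one_hahn_def minus_hahn.rep_eq uminus_hahn.rep_eq hmonom.rep_eq simp del: of_nat_Suc)
qed

lemma prod_hmonom:
  "(\<Prod>i\<in>A. hmonom (1::'a::comm_ring_1) (u i)) = hmonom 1 (\<Sum>i\<in>A. u i)"
  for u :: "'i \<Rightarrow> 'g::linordered_ab_group_add"
  by (induction A rule: infinite_finite_induct) (simp_all add: one_hahn_def hmonom_mult)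

text \<open>
  \<open>H\<close> is the convergent sum of the monomials \<open>c k \<cdot> t\<^sup>\<epsilon>\<^sup>k\<close> over \<open>k \<in> K\<close>.
\<close>

definition expands_as ::
  "('g::linordered_ab_group_add, 'a::comm_ring_1) hahn \<Rightarrow> 'k set \<Rightarrow> ('k \<Rightarrow> 'g) \<Rightarrow> ('k \<Rightarrow> 'a) \<Rightarrow> bool" where
  "expands_as H K \<epsilon> c \<longleftrightarrow> wfp_on (\<epsilon> ` K) (<) \<and> (\<forall>e. finite {k \<in> K. \<epsilon> k = e}) \<and>
     (\<forall>e. hcoeff H e = (\<Sum>k | k \<in> K \<and> \<epsilon> k = e. c k))"

lemma expands_as_1: "expands_as 1 {k} (\<lambda>_. 0) (\<lambda>_. 1)"
proof -
  have "{k'. k' = k \<and> (0::'a) = e} = (if e = 0 then {k} else {})" for e :: 'a by auto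
  then show ?thesis
    by (auto simp: expands_as_def wfp_on_singleton one_hahn_def hmonom.rep_eq)
qed

lemma expands_as_hsupp:
  assumes "expands_as H K \<epsilon> c"
  shows "hsupp H \<subseteq> \<epsilon> ` K"
proof
  fix e assume "e \<in> hsupp H"
  then have "(\<Sum>k | k \<in> K \<and> \<epsilon> k = e. c k) \<noteq> 0" using assms by (simp add: hsupp_def expands_as_def)
  then have "{k. k \<in> K \<and> \<epsilon> k = e} \<noteq> {}" by (intro notI) simp
  then show "e \<in> \<epsilon> ` K" by auto
qed

text \<open>Two well-ordered sets of exponents contain finitely many pairs with a given sum, so the
  coefficient of the product can be regrouped by pairs of indices.\<close>

lemma expands_as_mult:
  assumes "expands_as G K \<epsilon> c" "expands_as H L \<delta> d"
  shows "expands_as (G * H) (K \<times> L) (\<lambda>(k, l). \<epsilon> k + \<delta> l) (\<lambda>(k, l). c k * d l)"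
proof -
  have G: "wfp_on (\<epsilon> ` K) (<)" "\<And>e. finite {k \<in> K. \<epsilon> k = e}"
      "\<And>e. hcoeff G e = (\<Sum>k | k \<in> K \<and> \<epsilon> k = e. c k)"
    and H: "wfp_on (\<delta> ` L) (<)" "\<And>e. finite {l \<in> L. \<delta> l = e}"
      "\<And>e. hcoeff H e = (\<Sum>l | l \<in> L \<and> \<delta> l = e. d l)"
    using assms by (simp_all add: expands_as_def)
  let ?T = "\<lambda>e. {(u, v). u \<in> \<epsilon> ` K \<and> v \<in> \<delta> ` L \<and> u + v = e}"
  let ?S = "\<lambda>e. {(k, l). k \<in> K \<and> l \<in> L \<and> \<epsilon> k + \<delta> l = e}"
  have finT: "finite (?T e)" for e by (rule finite_sum_decompositions[OF G(1) H(1)])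
  have fib: "{p \<in> ?S e. map_prod \<epsilon> \<delta> p = (u, v)} = {k \<in> K. \<epsilon> k = u} \<times> {l \<in> L. \<delta> l = v}"
    if "u + v = e" for u v e using that by auto
  have finS: "finite (?S e)" for e
  proof (rule finite_subset)
    show "?S e \<subseteq> (\<Union>p\<in>?T e. {k \<in> K. \<epsilon> k = fst p} \<times> {l \<in> L. \<delta> l = snd p})" by fastforce
    show "finite (\<Union>p\<in>?T e. {k \<in> K. \<epsilon> k = fst p} \<times> {l \<in> L. \<delta> l = snd p})"
      by (intro finite_UN_I finT finite_cartesian_product G(2) H(2))
  qed
  note hsupp = assms[THEN expands_as_hsupp]
  have "hcoeff (G * H) e = (\<Sum>(k, l)\<in>?S e. c k * d l)" for e
  proof -
    have "hcoeff (G * H) e = (\<Sum>(u, v)\<in>?T e. hcoeff G u * hcoeff H v)"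
      by (rule hcoeff_times_superset[OF G(1) H(1) hsupp])
    also have "\<dots> = (\<Sum>q\<in>?T e. \<Sum>p | p \<in> ?S e \<and> map_prod \<epsilon> \<delta> p = q. c (fst p) * d (snd p))"
    proof (rule sum.cong[OF refl])
      fix q assume "q \<in> ?T e"
      then obtain u v where q: "q = (u, v)" "u + v = e" by auto
      show "(case q of (u, v) \<Rightarrow> hcoeff G u * hcoeff H v) =
          (\<Sum>p | p \<in> ?S e \<and> map_prod \<epsilon> \<delta> p = q. c (fst p) * d (snd p))"
        unfolding q(1) fib[OF q(2)] by (simp add: G(3) H(3) sum_product sum.cartesian_product case_prod_beta)
    qed
    also have "\<dots> = (\<Sum>p\<in>?S e. c (fst p) * d (snd p))"
      by (rule sum.group[OF finS finT]) auto
    finally show ?thesis by (simp add: case_prod_beta)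
  qed
  moreover have "{p \<in> K \<times> L. (case p of (k, l) \<Rightarrow> \<epsilon> k + \<delta> l) = e} = ?S e" for e by auto
  moreover have "wfp_on ((\<lambda>(k, l). \<epsilon> k + \<delta> l) ` (K \<times> L)) (<)"
    by (rule wfp_on_subset[OF wfp_on_less_sumset[OF G(1) H(1)]]) auto
  ultimately show ?thesis
    unfolding expands_as_def using finS by simp
qed

text \<open>Used to turn the index pairs of a binary product into choice functions on the enlarged
  set of factors.\<close>

lemma expands_as_reindex:
  assumes "expands_as H K \<epsilon> c" "bij_betw h L K"
    and "\<And>l. l \<in> L \<Longrightarrow> \<delta> l = \<epsilon> (h l)" "\<And>l. l \<in> L \<Longrightarrow> d l = c (h l)"
  shows "expands_as H L \<delta> d"
proof -
  have H: "wfp_on (\<epsilon> ` K) (<)" "\<And>e. finite {k \<in> K. \<epsilon> k = e}"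
      "\<And>e. hcoeff H e = (\<Sum>k | k \<in> K \<and> \<epsilon> k = e. c k)"
    using assms(1) by (simp_all add: expands_as_def)
  have bij: "bij_betw h {l \<in> L. \<delta> l = e} {k \<in> K. \<epsilon> k = e}" for e
  proof (rule bij_betwI')
    fix k assume "k \<in> {k \<in> K. \<epsilon> k = e}"
    then show "\<exists>l\<in>{l \<in> L. \<delta> l = e}. k = h l"
      using assms(2,3) unfolding bij_betw_def by force
  qed (use assms(2,3) in \<open>auto simp: bij_betw_def inj_on_def\<close>)
  have "\<delta> ` L = \<epsilon> ` K"
    using assms(2,3) by (force simp: bij_betw_def image_iff)
  moreover have "hcoeff H e = (\<Sum>l | l \<in> L \<and> \<delta> l = e. d l)" for e
    unfolding H(3) sum.reindex_bij_betw[OF bij, symmetric] by (rule sum.cong) (auto simp: assms(4))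
  ultimately show ?thesis
    unfolding expands_as_def using H(1,2) bij_betw_finite[OF bij] by simp
qed

lemma expands_as_prod:
  assumes "finite I" "\<And>i. i \<in> I \<Longrightarrow> expands_as (H i) (K i) (\<epsilon> i) (c i)"
  shows "expands_as (\<Prod>i\<in>I. H i) (PiE I K) (\<lambda>p. \<Sum>i\<in>I. \<epsilon> i (p i)) (\<lambda>p. \<Prod>i\<in>I. c i (p i))"
  using assms
proof (induction I)
  case empty
  then show ?case by (simp add: expands_as_1)
next
  case (insert i I)
  have "expands_as (H i * (\<Prod>i\<in>I. H i)) (K i \<times> PiE I K)
      (\<lambda>(k, p). \<epsilon> i k + (\<Sum>i\<in>I. \<epsilon> i (p i))) (\<lambda>(k, p). c i k * (\<Prod>i\<in>I. c i (p i)))"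
    using insert by (intro expands_as_mult) auto
  then have "expands_as (H i * (\<Prod>i\<in>I. H i)) (PiE (insert i I) K)
      (\<lambda>p. \<Sum>j\<in>insert i I. \<epsilon> j (p j)) (\<lambda>p. \<Prod>j\<in>insert i I. c j (p j))"
  proof (rule expands_as_reindex)
    show "bij_betw (\<lambda>p. (p i, restrict p I)) (PiE (insert i I) K) (K i \<times> PiE I K)"
      by (rule bij_betw_byWitness[where f' = "\<lambda>(k, p). p(i := k)"])
         (use insert.hyps in \<open>auto simp: PiE_iff extensional_def fun_eq_iff restrict_def split: if_splits\<close>)
  next
    fix p assume "p \<in> PiE (insert i I) K"
    have "(\<Sum>j\<in>I. \<epsilon> j (p j)) = (\<Sum>j\<in>I. \<epsilon> j (restrict p I j))"
         "(\<Prod>j\<in>I. c j (p j)) = (\<Prod>j\<in>I. c j (restrict p I j))" by simp_all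
    then show "(\<Sum>j\<in>insert i I. \<epsilon> j (p j)) =
        (case (p i, restrict p I) of (k, p) \<Rightarrow> \<epsilon> i k + (\<Sum>i\<in>I. \<epsilon> i (p i)))"
      and "(\<Prod>j\<in>insert i I. c j (p j)) =
        (case (p i, restrict p I) of (k, p) \<Rightarrow> c i k * (\<Prod>i\<in>I. c i (p i)))"
      using insert.hyps by simp_all
  qed
  then show ?case by (simp only: prod.insert[OF insert.hyps])
qed

lemma expands_as_hsubst:
  fixes u v :: "'g::linordered_ab_group_add" and f :: "nat \<Rightarrow> nat \<Rightarrow> 'a::comm_ring_1"
  assumes "u > 0" "v > 0"
  shows "expands_as (hsubst f (hmonom 1 u) (hmonom 1 v)) UNIV
    (\<lambda>(a, c). (\<Sum>i<a. u) + (\<Sum>i<c. v)) (\<lambda>(a, c). f a c)"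
proof -
  note wf = wfp_on_less_sumset[OF wfp_on_less_multiples(1)[OF assms(1)] wfp_on_less_multiples(1)[OF assms(2)]]
  have "wfp_on (range (\<lambda>(a::nat, c::nat). (\<Sum>i<a. u) + (\<Sum>i<c. v))) (<)"
    by (rule wfp_on_subset[OF wf]) auto
  moreover have "{k. (case k of (a::nat, c::nat) \<Rightarrow> (\<Sum>i<a. u) + (\<Sum>i<c. v)) = e} =
      {(a, c). (\<Sum>i<a. u) + (\<Sum>i<c. v) = e}" for e by auto
  ultimately show ?thesis
    using hcoeff_hsubst_hmonom(1)[OF assms] hcoeff_hsubst_hmonom(2)[OF assms, of f] by (simp add: expands_as_def)
qed

section \<open>Exponents in the integrand\<close>

abbreviation unit_exp :: "nat \<Rightarrow> nat \<Rightarrow>\<^sub>0 int" where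
  "unit_exp k \<equiv> Poly_Mapping.single k 1"

lemma idx_eq_iff [simp]:
  "x_idx i = x_idx j \<longleftrightarrow> i = j" "z_idx i = z_idx j \<longleftrightarrow> i = j" "x_idx i \<noteq> z_idx j" "z_idx i \<noteq> x_idx j"
  by (auto simp: x_idx_def z_idx_def) presburger+

text \<open>Simplification rewrites the constant sums that stand for multiples of an exponent into
  products with \<open>of_nat\<close>; this reads off their coordinates.\<close>

lemma lookup_of_nat_times:
  "Poly_Mapping.lookup (of_nat n * u) k = int n * Poly_Mapping.lookup (u :: nat \<Rightarrow>\<^sub>0 int) k"
proof -
  have "of_nat n * u = (\<Sum>i<n. u)" by simp
  then show ?thesis by (simp only: lookup_sum) simp
qed

lemma sum_const_single: "(\<Sum>i<n::nat. Poly_Mapping.single k (m::int)) = Poly_Mapping.single k (int n * m)"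
  by (rule poly_mapping_eqI) (simp add: lookup_sum lookup_single when_def del: sum_constant, simp)

lemma sum_lessThan_split:
  fixes h :: "nat \<Rightarrow> 'a::comm_monoid_add"
  assumes "0 < b"
  shows "(\<Sum>i<b. h i) = h 0 + (\<Sum>i=1..<b. h i)"
  using assms by (simp add: lessThan_atLeast0 sum.atLeast_Suc_lessThan)

definition XE :: "nat \<Rightarrow> nat \<Rightarrow>\<^sub>0 int" where "XE b = (\<Sum>i=2..b. unit_exp (x_idx i))"
definition ZE :: "nat \<Rightarrow> nat \<Rightarrow>\<^sub>0 int" where "ZE b = (\<Sum>i=2..b. unit_exp (z_idx i))"

text \<open>
  Exponents of the arguments of the \<open>b\<close> copies of \<open>F\<close>: number 0 is \<open>F(X,Z)\<close> and number
  \<open>i\<close> is \<open>F(x/x\<^sub>i\<^sub>+\<^sub>1, z/z\<^sub>i\<^sub>+\<^sub>1)\<close>.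
\<close>

definition xarg :: "nat \<Rightarrow> nat \<Rightarrow> nat \<Rightarrow>\<^sub>0 int" where
  "xarg b i = (if i = 0 then XE b else unit_exp (x_idx 0) - unit_exp (x_idx (Suc i)))"

definition zarg :: "nat \<Rightarrow> nat \<Rightarrow> nat \<Rightarrow>\<^sub>0 int" where
  "zarg b i = (if i = 0 then ZE b else unit_exp (z_idx 0) - unit_exp (z_idx (Suc i)))"

text \<open>Exponents of the Vandermonde nodes \<open>x/X, x\<^sub>2, \<dots>, x\<^sub>b\<close>.\<close>

definition node_exp :: "nat \<Rightarrow> nat \<Rightarrow> nat \<Rightarrow>\<^sub>0 int" where
  "node_exp b i = (if i = 0 then unit_exp (x_idx 0) - XE b else unit_exp (x_idx (Suc i)))"

lemma lookup_XE:
  "Poly_Mapping.lookup (XE b) (x_idx r) = (if 2 \<le> r \<and> r \<le> b then 1 else 0)"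
  "Poly_Mapping.lookup (XE b) (z_idx r) = 0"
  by (simp_all add: XE_def lookup_sum lookup_single when_def)

lemma lookup_ZE:
  "Poly_Mapping.lookup (ZE b) (z_idx r) = (if 2 \<le> r \<and> r \<le> b then 1 else 0)"
  "Poly_Mapping.lookup (ZE b) (x_idx r) = 0"
  by (simp_all add: ZE_def lookup_sum lookup_single when_def)

lemma idx_cases:
  obtains r where "k = x_idx r" | r where "k = z_idx r"
  unfolding x_idx_def z_idx_def by (metis evenE oddE)

lemma exponent_eqI:
  assumes "\<And>r. Poly_Mapping.lookup e (x_idx r) = Poly_Mapping.lookup e' (x_idx r)"
    and "\<And>r. Poly_Mapping.lookup e (z_idx r) = Poly_Mapping.lookup e' (z_idx r)"
  shows "e = e'"
proof (rule poly_mapping_eqI)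
  fix k show "Poly_Mapping.lookup e k = Poly_Mapping.lookup e' k"
    by (rule idx_cases[of k]) (use assms in auto)
qed

lemma sum_contour_vars:
  "(\<Sum>k\<in>contour_vars b. unit_exp k) = XE b + ZE b"
proof -
  have "(\<Sum>k\<in>contour_vars b. unit_exp k) =
      (\<Sum>k\<in>x_idx ` {2..b}. unit_exp k) + (\<Sum>k\<in>z_idx ` {2..b}. unit_exp k)"
    unfolding contour_vars_def by (rule sum.union_disjoint) auto
  also have "\<dots> = XE b + ZE b"
    unfolding XE_def ZE_def by (simp add: sum.reindex inj_on_def)
  finally show ?thesis .
qed

lemma lookup_zero_on_contour_vars_iff:
  "(\<forall>k\<in>contour_vars b. Poly_Mapping.lookup e k = 0) \<longleftrightarrow>
     (\<forall>r\<in>{2..b}. Poly_Mapping.lookup e (x_idx r) = 0 \<and> Poly_Mapping.lookup e (z_idx r) = 0)"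
  by (auto simp: contour_vars_def)

text \<open>Exponent of the \<open>\<sigma>\<close>-th term in the expansion of everything except the factors \<open>F\<close>.\<close>

definition perm_exp :: "nat \<Rightarrow> (nat \<Rightarrow> nat) \<Rightarrow> nat \<Rightarrow>\<^sub>0 int" where
  "perm_exp b \<sigma> = (\<Sum>i<b. \<Sum>_<\<sigma> i. node_exp b i) - XE b - (\<Sum>i=2..b. Poly_Mapping.single (z_idx i) (int i))"

text \<open>The last summand is the shift made by taking the residue.\<close>

definition term_exp :: "nat \<Rightarrow> (nat \<Rightarrow> nat) \<Rightarrow> (nat \<Rightarrow> nat \<times> nat) \<Rightarrow> nat \<Rightarrow>\<^sub>0 int" where
  "term_exp b \<sigma> p = (\<Sum>i<b. (\<Sum>_<fst (p i). xarg b i) + (\<Sum>_<snd (p i). zarg b i)) + perm_exp b \<sigma> + (XE b + ZE b)"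

text \<open>A contour coordinate with number r sees factor 0, which involves all contour variables,
  and otherwise only factor r - 1.\<close>

lemma sum_lessThan_delta:
  fixes g :: "nat \<Rightarrow> int"
  assumes "\<And>i. 1 \<le> i \<Longrightarrow> i < b \<Longrightarrow> h i = (if Suc i = r then g i else 0)" "0 < b"
  shows "(\<Sum>i<b. h i) = h 0 + (if 2 \<le> r \<and> r \<le> b then g (r - 1) else 0)"
proof -
  have "(\<Sum>i<b. h i) = h 0 + (\<Sum>i\<in>{1..<b}. h i)"
    by (rule sum_lessThan_split[OF assms(2)])
  also have "(\<Sum>i\<in>{1..<b}. h i) = (\<Sum>i\<in>{1..<b}. if i = r - 1 then (if r = 0 then 0 else g i) else 0)"
    by (rule sum.cong) (auto simp: assms(1))
  also have "\<dots> = (if 2 \<le> r \<and> r \<le> b then g (r - 1) else 0)" by auto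
  finally show ?thesis .
qed

text \<open>These are the equations imposed by the residue. In \<open>x_r\<close> the exponent -1 of
  the remaining 1/X cancels against the residue shift; in \<open>z_r\<close> the exponent -r becomes
  -(r - 1), so the second indices descend in steps of one.\<close>

lemma lookup_term_exp:
  assumes "0 < b"
  shows "Poly_Mapping.lookup (term_exp b \<sigma> p) (x_idx 0) = int (\<sigma> 0) + (\<Sum>i=1..<b. int (fst (p i)))"
    and "Poly_Mapping.lookup (term_exp b \<sigma> p) (z_idx 0) = (\<Sum>i=1..<b. int (snd (p i)))"
    and "0 < r \<Longrightarrow> Poly_Mapping.lookup (term_exp b \<sigma> p) (x_idx r) = (if 2 \<le> r \<and> r \<le> b
       then int (fst (p 0)) - int (\<sigma> 0) - (int (fst (p (r - 1))) - int (\<sigma> (r - 1))) else 0)"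
    and "0 < r \<Longrightarrow> Poly_Mapping.lookup (term_exp b \<sigma> p) (z_idx r) = (if 2 \<le> r \<and> r \<le> b
       then int (snd (p 0)) - int (snd (p (r - 1))) - int (r - 1) else 0)"
proof -
  note defs = term_exp_def perm_exp_def xarg_def zarg_def node_exp_def
  note lk = lookup_of_nat_times lookup_add lookup_minus lookup_sum lookup_XE lookup_ZE lookup_single when_def
  show "Poly_Mapping.lookup (term_exp b \<sigma> p) (x_idx 0) = int (\<sigma> 0) + (\<Sum>i=1..<b. int (fst (p i)))"
    unfolding defs by (simp add: lk sum_lessThan_split[OF assms])
  show "Poly_Mapping.lookup (term_exp b \<sigma> p) (z_idx 0) = (\<Sum>i=1..<b. int (snd (p i)))"
    unfolding defs by (simp add: lk sum_lessThan_split[OF assms])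
  assume r: "0 < r"
  show "Poly_Mapping.lookup (term_exp b \<sigma> p) (x_idx r) = (if 2 \<le> r \<and> r \<le> b
       then int (fst (p 0)) - int (\<sigma> 0) - (int (fst (p (r - 1))) - int (\<sigma> (r - 1))) else 0)"
  proof -
    have 1: "(\<Sum>i<b. Poly_Mapping.lookup (\<Sum>_<fst (p i). xarg b i) (x_idx r)) =
        (if 2 \<le> r \<and> r \<le> b then int (fst (p 0)) - int (fst (p (r - 1))) else 0)"
      by (subst sum_lessThan_delta[where g = "\<lambda>i. - int (fst (p i))" and r = r])
         (use assms r in \<open>auto simp: lk xarg_def\<close>)
    have 2: "(\<Sum>i<b. Poly_Mapping.lookup (\<Sum>_<snd (p i). zarg b i) (x_idx r)) = 0"
      by (rule sum.neutral) (auto simp: lk zarg_def)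
    have 3: "(\<Sum>i<b. Poly_Mapping.lookup (\<Sum>_<\<sigma> i. node_exp b i) (x_idx r)) =
        (if 2 \<le> r \<and> r \<le> b then int (\<sigma> (r - 1)) - int (\<sigma> 0) else 0)"
      by (subst sum_lessThan_delta[where g = "\<lambda>i. int (\<sigma> i)" and r = r])
         (use assms r in \<open>auto simp: lk node_exp_def\<close>)
    show ?thesis
      unfolding term_exp_def perm_exp_def lookup_add lookup_minus lookup_sum[of _ "{..<b}"] sum.distrib 1 2 3
      by (simp add: lk)
  qed
  show "Poly_Mapping.lookup (term_exp b \<sigma> p) (z_idx r) = (if 2 \<le> r \<and> r \<le> b
       then int (snd (p 0)) - int (snd (p (r - 1))) - int (r - 1) else 0)"
  proof -
    have 1: "(\<Sum>i<b. Poly_Mapping.lookup (\<Sum>_<snd (p i). zarg b i) (z_idx r)) =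
        (if 2 \<le> r \<and> r \<le> b then int (snd (p 0)) - int (snd (p (r - 1))) else 0)"
      by (subst sum_lessThan_delta[where g = "\<lambda>i. - int (snd (p i))" and r = r])
         (use assms r in \<open>auto simp: lk zarg_def\<close>)
    have 2: "(\<Sum>i<b. Poly_Mapping.lookup (\<Sum>_<fst (p i). xarg b i) (z_idx r)) = 0"
      by (rule sum.neutral) (auto simp: lk xarg_def)
    have 3: "(\<Sum>i<b. Poly_Mapping.lookup (\<Sum>_<\<sigma> i. node_exp b i) (z_idx r)) = 0"
      by (rule sum.neutral) (auto simp: lk node_exp_def)
    have 4: "(\<Sum>i=2..b. Poly_Mapping.lookup (Poly_Mapping.single (z_idx i) (int i)) (z_idx r)) =
        (if 2 \<le> r \<and> r \<le> b then int r else 0)"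
      by (simp add: lk)
    show ?thesis
      unfolding term_exp_def perm_exp_def lookup_add lookup_minus lookup_sum[of _ "{..<b}"]
        lookup_sum[of _ "{2..b}"] sum.distrib 1 2 3 4
      using r by (simp add: lk)
  qed
qed

text \<open>The exponent of the term with coefficient \<open>R\<^sup>(\<^sup>a\<^sup>)\<^sub>a\<^sub>+\<^sub>b\<^sub>+\<^sub>c\<^sub>,\<^sub>b\<close> in \<open>\<Phi>\<^sub>b\<close>.\<close>

definition Phi_exp :: "nat \<Rightarrow> nat \<Rightarrow> nat \<Rightarrow> nat \<Rightarrow>\<^sub>0 int" where
  "Phi_exp b a c = Poly_Mapping.single (x_idx 0) (int (b * (b - 1) div 2 + (b - 1) * a)) +
     Poly_Mapping.single (z_idx 0) (int ((b - 1) * (b - 2) div 2 + (b - 1) * c))"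

text \<open>Origin of the power of x in front of \<Phi>: node 0 contributes x to the power \<sigma>
  0, and factor i \<ge> 1 contributes \<sigma> i beyond the common a.\<close>

lemma sum_permutes:
  fixes \<sigma> :: "nat \<Rightarrow> nat"
  assumes "\<sigma> permutes {..<b}" "0 < b"
  shows "\<sigma> 0 + (\<Sum>i=1..<b. \<sigma> i) = b * (b - 1) div 2"
proof -
  have "\<sigma> 0 + (\<Sum>i=1..<b. \<sigma> i) = (\<Sum>i<b. \<sigma> i)"
    by (rule sum_lessThan_split[OF assms(2), symmetric])
  also have "\<dots> = (\<Sum>i<b. i)"
    by (rule sum.reindex_bij_betw[OF permutes_imp_bij[OF assms(1)]])
  also have "\<dots> = b * (b - 1) div 2" by (simp add: lessThan_atLeast0 Sum_Ico_nat)
  finally show ?thesis .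
qed

text \<open>Origin of the power of z in front of \<Phi>: factor i \<ge> 1 contributes b - 1 - i
  beyond the common c, and factor 0 contains no z.\<close>

lemma sum_decreasing: "(\<Sum>i=1..<b. b - Suc i) = (b - 1) * (b - 2) div 2"
proof -
  have "(\<Sum>i=1..<b. b - Suc i) = (\<Sum>i<b - 1. i)"
    by (rule sum.reindex_bij_witness[of _ "\<lambda>i. b - Suc i" "\<lambda>i. b - Suc i"]) auto
  also have "\<dots> = (b - 1) * (b - 1 - 1) div 2"
    by (simp add: lessThan_atLeast0 Sum_Ico_nat)
  finally show ?thesis by (simp add: numeral_2_eq_2)
qed

text \<open>The solutions of the residue equations for a fixed permutation, with \<open>a\<close>
  and \<open>c\<close> as free parameters.\<close>

definition shifted :: "nat \<Rightarrow> (nat \<Rightarrow> nat) \<Rightarrow> nat \<times> nat \<Rightarrow> nat \<Rightarrow> nat \<times> nat" where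
  "shifted b \<sigma> = (\<lambda>(a, c). restrict (\<lambda>i. (a + \<sigma> i, c + b - Suc i)) {..<b})"

text \<open>The exponent does not depend on \<sigma>, which is why the terms of all permutations
  combine into one determinant.\<close>

lemma term_exp_shifted:
  assumes \<sigma>: "\<sigma> permutes {..<b}" and b: "0 < b"
  shows "term_exp b \<sigma> (shifted b \<sigma> (a, c)) = Phi_exp b a c"
proof (rule exponent_eqI)
  fix r
  have "(\<Sum>i=1..<b. a + \<sigma> i) = (b - 1) * a + (\<Sum>i=1..<b. \<sigma> i)" by (simp add: sum.distrib)
  then have x0: "int (\<sigma> 0) + (\<Sum>i=1..<b. int (a + \<sigma> i)) = int (b * (b - 1) div 2 + (b - 1) * a)"
    using sum_permutes[OF assms] by (simp only: of_nat_sum[symmetric] of_nat_add[symmetric])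
  show "Poly_Mapping.lookup (term_exp b \<sigma> (shifted b \<sigma> (a, c))) (x_idx r) =
      Poly_Mapping.lookup (Phi_exp b a c) (x_idx r)"
  proof (cases "r = 0")
    case True
    then show ?thesis
      using x0 by (simp add: lookup_term_exp[OF b] shifted_def Phi_exp_def lookup_add lookup_single b)
  next
    case False
    then show ?thesis
      by (auto simp: lookup_term_exp[OF b] shifted_def Phi_exp_def lookup_add lookup_single when_def b)
  qed
  have "(\<Sum>i=1..<b. c + b - Suc i) = (\<Sum>i=1..<b. c + (b - Suc i))" by (rule sum.cong) auto
  also have "\<dots> = (b - 1) * c + (b - 1) * (b - 2) div 2" 
    by (simp only: sum.distrib sum_decreasing sum_constant card_atLeastLessThan of_nat_id)
  finally have z0: "(\<Sum>i=1..<b. int (c + b - Suc i)) = int ((b - 1) * (b - 2) div 2 + (b - 1) * c)"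
    by (simp only: of_nat_sum[symmetric] add.commute)
  show "Poly_Mapping.lookup (term_exp b \<sigma> (shifted b \<sigma> (a, c))) (z_idx r) =
      Poly_Mapping.lookup (Phi_exp b a c) (z_idx r)"
  proof (cases "r = 0")
    case True
    then show ?thesis
      using z0 by (simp add: lookup_term_exp[OF b] shifted_def Phi_exp_def lookup_add lookup_single b)
  next
    case False
    then show ?thesis
      by (auto simp: lookup_term_exp[OF b] shifted_def Phi_exp_def lookup_add lookup_single when_def b of_nat_diff)
  qed
qed

lemma term_exp_imp_shifted:
  assumes \<sigma>: "\<sigma> permutes {..<b}" and b: "0 < b" and p: "p \<in> {..<b} \<rightarrow>\<^sub>E UNIV"
    and zero: "\<forall>k\<in>contour_vars b. Poly_Mapping.lookup (term_exp b \<sigma> p) k = 0"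
  obtains a c where "p = shifted b \<sigma> (a, c)"
proof -
  have x: "int (fst (p i)) - int (\<sigma> i) = int (fst (p 0)) - int (\<sigma> 0)" if "i < b" for i
  proof (cases "i = 0")
    case False
    then show ?thesis
      using zero that unfolding lookup_zero_on_contour_vars_iff
      by (auto simp: lookup_term_exp[OF b] dest!: bspec[of _ _ "Suc i"])
  qed simp
  have z: "int (snd (p i)) + int i = int (snd (p 0))" if "i < b" for i
  proof (cases "i = 0")
    case False
    then show ?thesis
      using zero that unfolding lookup_zero_on_contour_vars_iff
      by (auto simp: lookup_term_exp[OF b] dest!: bspec[of _ _ "Suc i"])
  qed simp
  \<comment> \<open>The constant value of \<open>fst (p i) - \<sigma> i\<close> has to be a natural
    number; where \<sigma> i = 0 it is \<open>fst (p i)\<close>. Similarly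
    \<open>snd (p i) + i\<close> is at least b - 1, as the last factor shows.\<close>
  obtain i where i: "i < b" "\<sigma> i = 0"
    using permutes_surj[OF \<sigma>] permutes_in_image[OF \<sigma>] b by (metis lessThan_iff surj_def)
  define a c where "a = fst (p i)" and "c = snd (p (b - 1))"
  have "p j = shifted b \<sigma> (a, c) j" for j
  proof (cases "j < b")
    case True
    have "int (fst (p j)) = int (a + \<sigma> j)" using x[OF True] x[OF i(1)] i(2) by (simp add: a_def)
    moreover have "int (snd (p j)) = int (c + b - Suc j)"
      using z[OF True] z[of "b - 1"] b True by (simp add: c_def of_nat_diff)
    ultimately show ?thesis using True by (simp add: shifted_def prod_eq_iff del: of_nat_add)
  next
    case False
    then show ?thesis using PiE_arb[OF p, of j] by (simp add: shifted_def)
  qed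
  then show thesis using that by blast
qed

lemma inj_shifted:
  assumes "0 < b"
  shows "inj (shifted b \<sigma>)"
proof (rule injI)
  fix p q assume "shifted b \<sigma> p = shifted b \<sigma> q"
  then have "shifted b \<sigma> p 0 = shifted b \<sigma> q 0" by simp
  then show "p = q" using assms by (cases p; cases q) (auto simp: shifted_def)
qed

section \<open>The residue formula\<close>

lemma xv_monomials:
  "(\<Prod>i=2..b. xv i) = hmonom 1 (XE b)" "(\<Prod>i=2..b. zv i) = hmonom 1 (ZE b)"
  "(\<Prod>i=2..b. xinv i) = hmonom 1 (- XE b)"
  by (simp_all add: xv_def zv_def xinv_def XE_def ZE_def prod_hmonom single_uminus sum_negf)

text \<open>Positivity in the lexicographic order gives access to the coefficient formula for
  \<open>hsubst\<close>. For number 0 it depends on b \<ge> 2, as X and Z are otherwise empty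
  products.\<close>

lemma args_pos:
  assumes "2 \<le> b"
  shows "0 < xarg b i" "0 < zarg b i"
proof -
  have pos: "0 < (\<Sum>i=2..b. unit_exp (g i))" for g
    by (rule sum_pos) (use assms in \<open>auto intro: exponents_pos_single\<close>)
  show "0 < xarg b i"
    using pos exponents_pos(1)[of "Suc i"] by (simp add: xarg_def XE_def single_uminus)
  show "0 < zarg b i"
    using pos exponents_pos(2)[of "Suc i"] by (simp add: zarg_def ZE_def single_uminus)
qed

lemma hcoeff_prod_hsubst_args:
  assumes b: "2 \<le> b"
  shows "hcoeff (\<Prod>i<b. hsubst f (hmonom 1 (xarg b i)) (hmonom 1 (zarg b i))) e =
     (\<Sum>p | p \<in> {..<b} \<rightarrow>\<^sub>E UNIV \<and>
        (\<Sum>i<b. (\<Sum>_<fst (p i). xarg b i) + (\<Sum>_<snd (p i). zarg b i)) = e.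
        \<Prod>i<b. f (fst (p i)) (snd (p i)) :: real)"
proof -
  have "expands_as (\<Prod>i<b. hsubst f (hmonom 1 (xarg b i)) (hmonom 1 (zarg b i))) ({..<b} \<rightarrow>\<^sub>E UNIV)
      (\<lambda>p. \<Sum>i<b. case p i of (a, c) \<Rightarrow> (\<Sum>_<a. xarg b i) + (\<Sum>_<c. zarg b i))
      (\<lambda>p. \<Prod>i<b. case p i of (a, c) \<Rightarrow> f a c)"
    by (intro expands_as_prod expands_as_hsubst args_pos b) simp
  then show ?thesis by (simp add: expands_as_def case_prod_beta)
qed

lemma integrand_expansion:
  fixes f :: "nat \<Rightarrow> nat \<Rightarrow> real"
  assumes b: "2 \<le> b"
  defines "F \<equiv> hsubst f"
  defines "x \<equiv> xv 0" and "z \<equiv> zv 0"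
  defines "X \<equiv> \<Prod>i=2..b. xv i" and "Z \<equiv> \<Prod>i=2..b. zv i"
  defines "Xinv \<equiv> \<Prod>i=2..b. xinv i"
  shows "(\<Prod>(i, j) | 2 \<le> i \<and> i < j \<and> j \<le> b. xv j - xv i) * (F X Z * Xinv ^ b) *
       (\<Prod>i=2..b. (X * xv i - x) * zinv i ^ i * F (x * xinv i) (z * zinv i)) =
     (\<Sum>\<sigma> | \<sigma> permutes {..<b}. of_int (sign \<sigma>) * (hmonom 1 (perm_exp b \<sigma>) *
        (\<Prod>i<b. hsubst f (hmonom 1 (xarg b i)) (hmonom 1 (zarg b i)))))"
proof -
  define y where "y = (\<lambda>i. hmonom 1 (node_exp b i) :: laurent)"
  define G where "G = (\<lambda>i. hsubst f (hmonom 1 (xarg b i)) (hmonom 1 (zarg b i)))"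
  have y_0: "y 0 = x * Xinv"
    by (simp add: y_def node_exp_def x_def Xinv_def xv_monomials xv_def hmonom_mult)
  have y_Suc: "y i = xv (Suc i)" if "0 < i" for i
    using that by (simp add: y_def node_exp_def xv_def)
  have G_0: "G 0 = F X Z"
    by (simp add: G_def F_def X_def Z_def xv_monomials xarg_def zarg_def)
  have G_Suc: "G i = F (x * xinv (Suc i)) (z * zinv (Suc i))" if "0 < i" for i
    using that by (simp add: G_def F_def x_def z_def xv_def zv_def xinv_def zinv_def hmonom_mult
        xarg_def zarg_def single_uminus)
  have XX: "X * Xinv = 1"
    by (simp add: X_def Xinv_def prod.distrib[symmetric] xv_xinv)
  have shift: "(\<Prod>i=2..b. h i) = (\<Prod>i=1..<b. h (Suc i))" for h :: "nat \<Rightarrow> laurent"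
    by (rule prod.reindex_bij_witness[of _ Suc "\<lambda>i. i - 1"]) auto
  have split: "(\<Prod>i<n. h i) = h 0 * (\<Prod>i=1..<n. h i)" if "0 < n" for n and h :: "nat \<Rightarrow> laurent"
    using that by (simp add: lessThan_atLeast0 prod.atLeast_Suc_lessThan)
  \<comment> \<open>The differences with node 0 are split off, since they stem from the factors
    \<open>X * xv i - x\<close> and the others from the product already present.\<close>
  have "(\<Prod>j<b. \<Prod>i<j. y j - y i) = (\<Prod>j=1..<b. \<Prod>i<j. y j - y i)"
    using b by (subst split) auto
  also have "\<dots> = (\<Prod>j=1..<b. (y j - y 0) * (\<Prod>i=1..<j. y j - y i))"
    by (rule prod.cong[OF refl], rule split) simp
  also have "\<dots> = (\<Prod>j=1..<b. y j - y 0) * (\<Prod>j=1..<b. \<Prod>i=1..<j. y j - y i)"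
    by (rule prod.distrib)
  also have "(\<Prod>j=1..<b. \<Prod>i=1..<j. y j - y i) = (\<Prod>(j, i)\<in>(SIGMA j:{1..<b}. {1..<j}). y j - y i)"
    by (rule prod.Sigma) auto
  also have "\<dots> = (\<Prod>(i, j) | 2 \<le> i \<and> i < j \<and> j \<le> b. xv j - xv i)"
    by (rule prod.reindex_bij_witness[of _ "\<lambda>(i, j). (j - 1, i - 1)" "\<lambda>(j, i). (Suc i, Suc j)"])
       (auto simp: y_Suc)
  finally have vander: "(\<Prod>j<b. \<Prod>i<j. y j - y i) =
    (\<Prod>j=1..<b. y j - y 0) * (\<Prod>(i, j) | 2 \<le> i \<and> i < j \<and> j \<le> b. xv j - xv i)" .
  have factor: "X * xv (Suc i) - x = X * (y i - y 0)" if "0 < i" for i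
  proof -
    have "X * (y i - y 0) = X * xv (Suc i) - (X * Xinv) * x"
      using that by (simp add: y_0 y_Suc algebra_simps)
    then show ?thesis by (simp add: XX)
  qed
  have "(\<Prod>i=2..b. (X * xv i - x) * zinv i ^ i * F (x * xinv i) (z * zinv i)) =
      (\<Prod>i=1..<b. (X * (y i - y 0)) * zinv (Suc i) ^ Suc i * G i)"
    unfolding shift by (rule prod.cong[OF refl], subst G_Suc, simp, subst factor, simp_all)
  also have "\<dots> = X ^ (b - 1) * (\<Prod>i=1..<b. y i - y 0) * (\<Prod>i=2..b. zinv i ^ i) * (\<Prod>i=1..<b. G i)"
    by (simp add: prod.distrib shift)
  finally have "(\<Prod>(i, j) | 2 \<le> i \<and> i < j \<and> j \<le> b. xv j - xv i) * (F X Z * Xinv ^ b) *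
       (\<Prod>i=2..b. (X * xv i - x) * zinv i ^ i * F (x * xinv i) (z * zinv i)) =
     (\<Prod>j<b. \<Prod>i<j. y j - y i) * (X ^ (b - 1) * Xinv ^ b * (\<Prod>i=2..b. zinv i ^ i)) * (\<Prod>i<b. G i)"
    using b by (simp add: vander split[of b G] G_0 mult_ac)
  \<comment> \<open>Extracting the node differences leaves b - 1 factors X; against the b-th power
    of 1/X a single 1/X survives.\<close>
  also have "X ^ (b - 1) * Xinv ^ b = (X * Xinv) ^ (b - 1) * Xinv"
    using b by (cases b) (simp_all add: power_mult_distrib mult_ac)
  also have "\<dots> = Xinv" by (simp add: XX)
  also have "(\<Prod>j<b. \<Prod>i<j. y j - y i) * (Xinv * (\<Prod>i=2..b. zinv i ^ i)) * (\<Prod>i<b. G i) =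
      (\<Sum>\<sigma> | \<sigma> permutes {..<b}. of_int (sign \<sigma>) *
        ((\<Prod>i<b. y i ^ \<sigma> i) * (Xinv * (\<Prod>i=2..b. zinv i ^ i)) * (\<Prod>i<b. G i)))"
    unfolding vandermonde_leibniz by (simp only: sum_distrib_right mult.assoc)
  also have "\<dots> = (\<Sum>\<sigma> | \<sigma> permutes {..<b}. of_int (sign \<sigma>) * (hmonom 1 (perm_exp b \<sigma>) * (\<Prod>i<b. G i)))"
  proof (rule sum.cong[OF refl])
    fix \<sigma>
    have "(\<Prod>i=2..b. zinv i ^ i) = hmonom 1 (- (\<Sum>i=2..b. Poly_Mapping.single (z_idx i) (int i)))"
      by (simp add: zinv_def hmonom_1_power sum_const_single prod_hmonom single_uminus sum_negf del: sum_constant)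
    moreover have "(\<Prod>i<b. y i ^ \<sigma> i) = hmonom 1 (\<Sum>i<b. \<Sum>_<\<sigma> i. node_exp b i)"
      by (simp only: y_def hmonom_1_power prod_hmonom)
    ultimately have "(\<Prod>i<b. y i ^ \<sigma> i) * (Xinv * (\<Prod>i=2..b. zinv i ^ i)) = hmonom 1 (perm_exp b \<sigma>)"
      by (simp add: Xinv_def xv_monomials hmonom_mult perm_exp_def algebra_simps)
    then show "of_int (sign \<sigma>) * ((\<Prod>i<b. y i ^ \<sigma> i) * (Xinv * (\<Prod>i=2..b. zinv i ^ i)) * (\<Prod>i<b. G i)) =
        of_int (sign \<sigma>) * (hmonom 1 (perm_exp b \<sigma>) * (\<Prod>i<b. G i))" by simp
  qed
  finally show ?thesis by (simp only: G_def)
qed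

text \<open>A formal identity for an arbitrary array \<open>f\<close>. The comparison takes place at
  one exponent at a time, where all sums are finite, so no interchange of the residue with an
  infinite sum arises.\<close>

theorem residue_eq_det_series:
  fixes f :: "nat \<Rightarrow> nat \<Rightarrow> real" and x z X Z Xinv :: laurent
  assumes b: "2 \<le> b"
  defines "F \<equiv> hsubst f"
  defines "x \<equiv> xv 0" and "z \<equiv> zv 0"
  defines "X \<equiv> \<Prod>i=2..b. xv i" and "Z \<equiv> \<Prod>i=2..b. zv i"
  defines "Xinv \<equiv> \<Prod>i=2..b. xinv i"
  shows "residue_in (contour_vars b)
      ((\<Prod>(i, j) | 2 \<le> i \<and> i < j \<and> j \<le> b. xv j - xv i) * (F X Z * Xinv ^ b) *
       (\<Prod>i=2..b. (X * xv i - x) * zinv i ^ i * F (x * xinv i) (z * zinv i))) =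
    x ^ (b * (b - 1) div 2) * z ^ ((b - 1) * (b - 2) div 2) *
     hsubst (\<lambda>a c. det_fn b (\<lambda>i j. f (a + i) (c + b - Suc j))) (x ^ (b - 1)) (z ^ (b - 1))"
    (is "residue_in _ ?I = ?R")
proof (rule hahn_eqI)
  fix e
  have b0: "0 < b" using b by simp
  let ?Q = "{(a, c). Phi_exp b a c = e}"
  let ?P = "\<lambda>\<sigma>. {p \<in> {..<b} \<rightarrow>\<^sub>E UNIV. term_exp b \<sigma> p = e}"
  have "hcoeff ?R e = (\<Sum>(a, c)\<in>?Q. det_fn b (\<lambda>i j. f (a + i) (c + b - Suc j)))"
  proof -
    let ?u = "Poly_Mapping.single (x_idx 0) (int (b - 1))" and ?v = "Poly_Mapping.single (z_idx 0) (int (b - 1))"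
    let ?s = "Poly_Mapping.single (x_idx 0) (int (b * (b - 1) div 2)) +
      Poly_Mapping.single (z_idx 0) (int ((b - 1) * (b - 2) div 2))"
    have pw: "x ^ n = hmonom 1 (Poly_Mapping.single (x_idx 0) (int n))"
         "z ^ n = hmonom 1 (Poly_Mapping.single (z_idx 0) (int n))" for n
      by (simp_all add: x_def z_def xv_def zv_def hmonom_1_power sum_const_single del: sum_constant)
    have pos: "0 < Poly_Mapping.single (k::nat) (int (b - 1))" for k
      unfolding less_poly_mapping.rep_eq less_fun_def
      by (intro exI[of _ k]) (use b in \<open>auto simp: lookup_single when_def\<close>)
    have "hcoeff ?R e = hcoeff (hsubst (\<lambda>a c. det_fn b (\<lambda>i j. f (a + i) (c + b - Suc j)))
        (hmonom 1 ?u) (hmonom 1 ?v)) (e - ?s)"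
      unfolding pw hmonom_mult hcoeff_hmonom_times by simp
    also have "\<dots> = (\<Sum>(a, c) | (\<Sum>i<a. ?u) + (\<Sum>i<c. ?v) = e - ?s.
        det_fn b (\<lambda>i j. f (a + i) (c + b - Suc j)))"
      by (rule hcoeff_hsubst_hmonom(2)[OF pos pos])
    also have "{(a, c). (\<Sum>i<a. ?u) + (\<Sum>i<c. ?v) = e - ?s} = ?Q"
    proof -
      have "(\<Sum>i<a. ?u) + (\<Sum>i<c. ?v) + ?s = Phi_exp b a c" for a c
        unfolding sum_const_single Phi_exp_def of_nat_add of_nat_mult Poly_Mapping.single_add
        by (simp only: ac_simps)
      then show ?thesis by (simp only: eq_diff_eq)
    qed
    finally show ?thesis .
  qed
  also have "\<dots> = (if \<forall>k\<in>contour_vars b. Poly_Mapping.lookup e k = 0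
      then \<Sum>\<sigma> | \<sigma> permutes {..<b}. of_int (sign \<sigma>) * (\<Sum>p\<in>?P \<sigma>. \<Prod>i<b. f (fst (p i)) (snd (p i))) else 0)"
  proof (cases "\<forall>k\<in>contour_vars b. Poly_Mapping.lookup e k = 0")
    case True
    \<comment> \<open>The surviving choices of terms are parametrised by the same pairs (a, c) for
      every permutation, which allows the two sums to be exchanged.\<close>
    have P: "?P \<sigma> = shifted b \<sigma> ` ?Q" if \<sigma>: "\<sigma> permutes {..<b}" for \<sigma>
    proof (intro equalityI subsetI)
      fix p assume p: "p \<in> ?P \<sigma>"
      then obtain a c where "p = shifted b \<sigma> (a, c)"
        using term_exp_imp_shifted[OF \<sigma> b0, of p] True by auto
      then show "p \<in> shifted b \<sigma> ` ?Q" using p term_exp_shifted[OF \<sigma> b0, of a c] by auto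
    next
      fix p assume "p \<in> shifted b \<sigma> ` ?Q"
      then obtain a c where p: "p = shifted b \<sigma> (a, c)" "Phi_exp b a c = e" by blast
      have "shifted b \<sigma> (a, c) \<in> {..<b} \<rightarrow>\<^sub>E UNIV" by (simp add: shifted_def)
      then show "p \<in> ?P \<sigma>" using p term_exp_shifted[OF \<sigma> b0, of a c] by simp
    qed
    have "(\<Sum>(a, c)\<in>?Q. det_fn b (\<lambda>i j. f (a + i) (c + b - Suc j))) =
        (\<Sum>\<sigma> | \<sigma> permutes {..<b}. of_int (sign \<sigma>) * (\<Sum>(a, c)\<in>?Q. \<Prod>i<b. f (a + \<sigma> i) (c + b - Suc i)))"
      unfolding det_fn_def case_prod_beta by (subst sum.swap) (simp only: sum_distrib_left)
    also have "\<dots> = (\<Sum>\<sigma> | \<sigma> permutes {..<b}. of_int (sign \<sigma>) * (\<Sum>p\<in>?P \<sigma>. \<Prod>i<b. f (fst (p i)) (snd (p i))))"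
    proof (rule sum.cong[OF refl])
      fix \<sigma> assume "\<sigma> \<in> {\<sigma>. \<sigma> permutes {..<b}}"
      then have \<sigma>: "\<sigma> permutes {..<b}" by simp
      have inj: "inj_on (shifted b \<sigma>) ?Q" using inj_shifted[OF b0] by (rule inj_on_subset) simp
      have "(\<Sum>p\<in>?P \<sigma>. \<Prod>i<b. f (fst (p i)) (snd (p i))) =
          (\<Sum>(a, c)\<in>?Q. \<Prod>i<b. f (a + \<sigma> i) (c + b - Suc i))"
        unfolding P[OF \<sigma>] sum.reindex[OF inj] by (rule sum.cong) (auto simp: shifted_def)
      then show "of_int (sign \<sigma>) * (\<Sum>(a, c)\<in>?Q. \<Prod>i<b. f (a + \<sigma> i) (c + b - Suc i)) =
          of_int (sign \<sigma>) * (\<Sum>p\<in>?P \<sigma>. \<Prod>i<b. f (fst (p i)) (snd (p i)))" by simp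
    qed
    finally show ?thesis using True by simp
  next
    case False
    \<comment> \<open>Neither a residue nor a series in x and z contains contour variables, so both
      coefficients vanish at such an exponent.\<close>
    have "Poly_Mapping.lookup (Phi_exp b a c) k = 0" if "k \<in> contour_vars b" for a c k
      using that by (auto simp: contour_vars_def Phi_exp_def lookup_add lookup_single when_def)
    then have Q: "?Q = {}" using False by auto
    show ?thesis by (simp only: Q if_not_P[OF False] sum.empty)
  qed
  also have "\<dots> = hcoeff (residue_in (contour_vars b) ?I) e"
  proof -
    let ?d = "XE b + ZE b"
    have "hcoeff ?I (e - ?d) = (\<Sum>\<sigma> | \<sigma> permutes {..<b}. of_int (sign \<sigma>) *
        hcoeff (\<Prod>i<b. hsubst f (hmonom 1 (xarg b i)) (hmonom 1 (zarg b i))) (e - ?d - perm_exp b \<sigma>))"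
      unfolding F_def x_def z_def X_def Z_def Xinv_def integrand_expansion[OF b]
      by (simp add: hcoeff_sum of_int_hahn hcoeff_hmonom_times)
    also have "\<dots> = (\<Sum>\<sigma> | \<sigma> permutes {..<b}. of_int (sign \<sigma>) * (\<Sum>p\<in>?P \<sigma>. \<Prod>i<b. f (fst (p i)) (snd (p i))))"
      unfolding hcoeff_prod_hsubst_args[OF b] term_exp_def
      by (intro sum.cong refl arg_cong2[where f = "(*)"]) (auto simp: algebra_simps)
    finally show ?thesis by (simp add: residue_in.rep_eq sum_contour_vars)
  qed
  finally show "hcoeff (residue_in (contour_vars b) ?I) e = hcoeff ?R e" by simp
qed

theorem theorem5p9:
  fixes \<alpha> \<beta> \<gamma> b :: nat and x z X Z Xinv :: laurent and F :: "laurent \<Rightarrow> laurent \<Rightarrow> laurent"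
  assumes "\<alpha> \<ge> 1" and "\<beta> \<ge> 1" and "\<gamma> \<ge> 1" and "b \<ge> 2"
  defines "F \<equiv> F_series \<alpha> \<beta> \<gamma>"
  defines "x \<equiv> xv 0" and "z \<equiv> zv 0"
  defines "X \<equiv> \<Prod>i=2..b. xv i" and "Z \<equiv> \<Prod>i=2..b. zv i"
  defines "Xinv \<equiv> \<Prod>i=2..b. xinv i"
  shows "Phi_series \<alpha> \<beta> \<gamma> b x z =
    residue_in (contour_vars b)
      ((\<Prod>(i, j) | 2 \<le> i \<and> i < j \<and> j \<le> b. xv j - xv i) * (F X Z * Xinv ^ b) *
       (\<Prod>i=2..b. (X * xv i - x) * zinv i ^ i * F (x * xinv i) (z * zinv i)))"
  unfolding F_def F_series_def x_def z_def X_def Z_def Xinv_def residue_eq_det_series[OF assms(4)]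
    Phi_series_def Rect_eq_det[OF assms(1-3)] ..

end
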